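(* Let $n \ge 3$ be an integer, let $p$ be a real number with $1 < p \le \frac{n+2}{n-2}$, and let $q = \frac{2p}{p+1}$. Define $M_1 = \infty$ if $3 \le n \le 6$, and $$M_1 = (p+1)\left[\frac{(n-1)^2 q}{4n} - 1\right]^{-1}\left[\frac{n}{q} - \frac{n(n-1)}{n+2}\right]^{\frac{q}{2}} \quad \text{if } n \ge 7;$$ for every real $M$ with $0 < M < M_1$, every nonnegative solution on $\mathbb{R}^n$ of $\Delta v + v^p + M|\nabla v|^q = 0$ is identically zero. Then there is a real number $M_2 > 0$ with $$M_2 < M_1$$ such that, for every real $M > M_2$, every nonnegative solution on $\mathbb{R}^n$ of $\Delta v + v^p + M|\nabla v|^q = 0$ is identically zero.
   Context: A solution is a global classical solution: a function $v \in C^2(\mathbb{R}^n)$ satisfying the equation at every point of $\mathbb{R}^n$. Nonnegative means $v(x) \ge 0$ for all $x$. No condition on the behaviour of $v$ at infinity is imposed. *)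

theory Defs
  imports "HOL-Analysis.Analysis" "HOL-Library.Extended_Real"
begin

definition partial_deriv :: "'n::finite \<Rightarrow> (real ^ 'n \<Rightarrow> real) \<Rightarrow> real ^ 'n \<Rightarrow> real" where
  "partial_deriv i f x = frechet_derivative f (at x) (axis i 1)"

definition grad :: "(real ^ 'n::finite \<Rightarrow> real) \<Rightarrow> real ^ 'n \<Rightarrow> real ^ 'n" where
  "grad f x = (\<chi> i. partial_deriv i f x)"

definition laplacian :: "(real ^ 'n::finite \<Rightarrow> real) \<Rightarrow> real ^ 'n \<Rightarrow> real" where
  "laplacian f x = (\<Sum>i\<in>UNIV. partial_deriv i (partial_deriv i f) x)"

(* Differentiability is required explicitly at both orders because frechet_derivative
   is an unspecified value at points where the function is not differentiable. *)
definition C2_fun :: "(real ^ 'n::finite \<Rightarrow> real) \<Rightarrow> bool" where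
  "C2_fun f \<longleftrightarrow>
     f differentiable_on UNIV \<and>
     (\<forall>i. partial_deriv i f differentiable_on UNIV) \<and>
     (\<forall>i j. continuous_on UNIV (partial_deriv j (partial_deriv i f)))"

(* The real powers are harmless where their base vanishes: 0 powr a = 0, which is the
   right value because p and q are positive in the intended use. *)
definition nonneg_solution ::
    "real \<Rightarrow> real \<Rightarrow> real \<Rightarrow> (real ^ 'n::finite \<Rightarrow> real) \<Rightarrow> bool" where
  "nonneg_solution p q M v \<longleftrightarrow>
     C2_fun v \<and> (\<forall>x. v x \<ge> 0) \<and>
     (\<forall>x. laplacian v x + v x powr p + M * norm (grad v x) powr q = 0)"

definition q_exp :: "real \<Rightarrow> real" where
  "q_exp p = 2 * p / (p + 1)"

(* For n at least 7 and p in the range 1 < p \<le> (n + 2) / (n - 2), both bracketed terms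
   are positive, so inverse and powr have their usual meaning. *)
definition M1 :: "nat \<Rightarrow> real \<Rightarrow> ereal" where
  "M1 n p =
     (if n \<le> 6 then \<infinity>
      else ereal ((p + 1)
        * inverse ((real n - 1)\<^sup>2 * q_exp p / (4 * real n) - 1)
        * (real n / q_exp p - real n * (real n - 1) / (real n + 2)) powr (q_exp p / 2)))"

end

theory Submission
  imports Defs
begin

text \<open>
A nonnegative solution vanishes for \<^emph>\<open>every\<close> \<open>M > 0\<close>; given this, \<open>M2\<close> may be any positive number
below the (positive) threshold \<open>M1\<close>, and both claims are instances of \<open>nonneg_solution_eq_0\<close>.

A nonnegative solution is superharmonic, so by comparison with a Gaussian barrier it is either
identically zero or everywhere positive (\<open>superharmonic_positive\<close>). Suppose \<open>v > 0\<close>, and put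
\<open>X = |grad v|^2 / v\<close>, \<open>Y = v^p\<close>, \<open>Z = M |grad v|^q\<close>, \<open>F = Y + Z\<close>, so that the Laplacian is \<open>- F\<close>; let
\<open>h\<close> be the second derivative of \<open>v\<close> in the direction of its gradient. Because \<open>q = 2p/(p+1)\<close>, all these
quantities scale like the Hessian, and \<open>Z = M X^(q/2) Y^(1-q/2)\<close>. Bochner's formula with the weight
\<open>v^a\<close>, combined with Green's formula for the weights \<open>v^(a-1) |grad v|^2\<close>, \<open>v^(a+p)\<close> and
\<open>v^a |grad v|^q\<close>, gives an identity in which the integral of \<open>\<eta> v^a Q\<close> equals terms that contain the
gradient of the cutoff \<open>\<eta>\<close>, where \<open>Q\<close> is a quadratic expression in the Hessian and \<open>X, Y, Z\<close>
(\<open>weighted_identity\<close>). The solution is only twice differentiable, so Bochner's formula is used in a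
weak form that contains no third derivatives; it expresses that distributional derivatives commute
(\<open>weak_derivatives_commute\<close>), which follows from difference quotients.

The heart of the proof is to choose the four free coefficients so that \<open>Q\<close> is coercive
(\<open>coercive_coefficients\<close>). The condition on \<open>p\<close> says that \<open>p\<close> is the critical Sobolev exponent
\<open>(N+2)/(N-2)\<close> of the real dimension \<open>N = 2(p+1)/(p-1) \<ge> n\<close>, and the Hessian satisfies
\<open>|D^2 v|^2 \<ge> h^2 + (F + h)^2/(N-1)\<close>. In a one-parameter family of coefficients, completing the square
in \<open>h\<close> leaves, up to positive terms,
\<open>(\<theta> X - q Y) (A X - \<xi> Z)\<close> plus positive multiples of \<open>Y Z\<close> and \<open>Z^2\<close>
(\<open>form_decomposition\<close>); the value \<open>\<theta> = 1\<close> corresponds to \<open>A = 0\<close> and to the classical borderline choice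
for the equation without gradient term. On the curve \<open>Z = M X^(q/2) Y^(1-q/2)\<close> each of the two factors changes
sign exactly once as \<open>X/Y\<close> grows. For each \<open>M\<close> there is a \<open>\<theta>\<close> between 0 and 1 for which both change
sign at the same ratio, and then the product is nonnegative (\<open>balanced_parameter_exists\<close>,
\<open>reduced_form_coercive\<close>).

Coercivity and Young's inequality absorb the terms with the gradient of the cutoff for the ball of radius
\<open>R\<close>, apart from an error \<open>O(R^(n-\<sigma>))\<close> with \<open>\<sigma> = 2(a+2p)/(p-1) > n\<close>. Letting \<open>R\<close> tend to infinity,
the integral of \<open>v^(a+2p)\<close> over the unit ball would vanish, which is impossible (\<open>no_positive_solution\<close>).
\<close>

section \<open>Integration by parts for compactly supported functions\<close>

lemma integrable_continuous_bounded_support: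
  fixes f :: "'a::euclidean_space \<Rightarrow> real"
  assumes "continuous_on UNIV f" and "\<And>x. norm x > R \<Longrightarrow> f x = 0"
  shows "integrable lborel f"
proof -
  have "integrable lborel (\<lambda>x. indicator (cball 0 R) x *\<^sub>R f x)"
    by (rule borel_integrable_compact) (auto intro: continuous_on_subset[OF assms(1)])
  also have "(\<lambda>x. indicator (cball 0 R) x *\<^sub>R f x) = f"
    using assms(2) by (auto simp: fun_eq_iff indicator_def not_le)
  finally show ?thesis .
qed

lemma lborel_integral_translate:
  fixes f :: "'a::euclidean_space \<Rightarrow> real"
  assumes "f \<in> borel_measurable borel"
  shows "(\<integral>x. f (x + c) \<partial>lborel) = (\<integral>x. f x \<partial>lborel)"
proof -
  have "(\<integral>x. f x \<partial>lborel) = (\<integral>x. f x \<partial>(distr lborel borel ((+) c)))"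
    by (simp add: lborel_distr_plus)
  also have "\<dots> = (\<integral>x. f (c + x) \<partial>lborel)"
    using assms by (subst integral_distr) auto
  finally show ?thesis by (simp add: add.commute)
qed

text \<open>
The dominated convergence theorem applies because the mean value theorem bounds the difference
quotients on a ball. The support hypothesis concerns the product only, so that either factor may be
the one with bounded support.
\<close>

lemma difference_quotient_limit:
  fixes w F :: "'a::euclidean_space \<Rightarrow> real"
  assumes w: "continuous_on UNIV w"
    and F: "\<And>x. (F has_derivative F' x) (at x)"
    and cont: "continuous_on UNIV (\<lambda>x. F' x d)"
    and supp: "\<And>x h. norm x > R \<Longrightarrow> 0 < h \<Longrightarrow> h \<le> 1 \<Longrightarrow> w x * (F (x + h *\<^sub>R d) - F x) = 0"
  shows "integrable lborel (\<lambda>x. w x * F' x d)"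
    and "(\<lambda>k. \<integral>x. w x * ((F (x + (1 / Suc k) *\<^sub>R d) - F x) / (1 / Suc k)) \<partial>lborel)
           \<longlonglongrightarrow> (\<integral>x. w x * F' x d \<partial>lborel)"
proof -
  define s where "s k x = w x * ((F (x + (1 / Suc k) *\<^sub>R d) - F x) / (1 / Suc k))" for k x
  have Fc: "continuous_on UNIV F"
    using F by (meson continuous_at_imp_continuous_on has_derivative_continuous)
  obtain C where C: "\<And>x. norm x \<le> R + norm d \<Longrightarrow> \<bar>F' x d\<bar> \<le> C"
  proof -
    have "bounded ((\<lambda>x. F' x d) ` cball 0 (R + norm d))"
      by (intro compact_imp_bounded compact_continuous_image continuous_on_subset[OF cont]) auto
    then show ?thesis using that by (force simp: bounded_iff)
  qed
  obtain D where D: "\<And>x. norm x \<le> R \<Longrightarrow> \<bar>w x\<bar> \<le> D"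
  proof -
    have "bounded (w ` cball 0 R)"
      by (intro compact_imp_bounded compact_continuous_image continuous_on_subset[OF w]) auto
    then show ?thesis using that by (force simp: bounded_iff)
  qed
  have line: "((\<lambda>t. F (x + t *\<^sub>R d)) has_real_derivative F' (x + t *\<^sub>R d) d) (at t)" for x t
  proof -
    have "((\<lambda>t. F (x + t *\<^sub>R d)) has_derivative (\<lambda>h. F' (x + t *\<^sub>R d) (h *\<^sub>R d))) (at t)"
      by (rule has_derivative_compose[OF _ F]) (auto intro!: derivative_eq_intros)
    moreover have "F' (x + t *\<^sub>R d) (h *\<^sub>R d) = F' (x + t *\<^sub>R d) d * h" for h
      using has_derivative_linear[OF F] by (simp add: linear_scale)
    ultimately show ?thesis by (simp add: has_field_derivative_def)
  qed
  have bound: "\<bar>s k x\<bar> \<le> indicator (cball 0 R) x * (D * C)" for k x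
  proof (cases "norm x \<le> R")
    case False
    then show ?thesis using supp[of x "1 / Suc k"] by (auto simp: s_def)
  next
    case True
    have "\<exists>t. 0 < t \<and> t < 1 / Suc k \<and> F (x + (1 / Suc k) *\<^sub>R d) - F (x + 0 *\<^sub>R d)
             = (1 / Suc k - 0) * F' (x + t *\<^sub>R d) d"
      by (rule MVT2[where f = "\<lambda>t. F (x + t *\<^sub>R d)"]) (use line in auto)
    then obtain t where t: "0 < t" "t < 1 / Suc k"
      "F (x + (1 / Suc k) *\<^sub>R d) - F x = (1 / Suc k) * F' (x + t *\<^sub>R d) d" by auto
    have "t \<le> 1" using t(2) by (smt (verit) divide_le_eq_1 of_nat_Suc of_nat_0_le_iff)
    then have "norm (x + t *\<^sub>R d) \<le> R + norm d"
      using t(1) True by (smt (verit) norm_triangle_ineq norm_scaleR mult_left_le_one_le norm_ge_zero)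
    then have "\<bar>F' (x + t *\<^sub>R d) d\<bar> \<le> C" by (rule C)
    with D[OF True] have "\<bar>w x\<bar> * \<bar>F' (x + t *\<^sub>R d) d\<bar> \<le> D * C"
      by (intro mult_mono) auto
    moreover have "s k x = w x * F' (x + t *\<^sub>R d) d" unfolding s_def t(3) by simp
    ultimately show ?thesis using True by (simp add: abs_mult)
  qed
  have lim: "(\<lambda>k. s k x) \<longlonglongrightarrow> w x * F' x d" for x
  proof -
    have "((\<lambda>h. (F (x + h *\<^sub>R d) - F x) / h) \<longlongrightarrow> F' x d) (at 0)"
      using line[of x 0] by (simp add: DERIV_def)
    moreover have "filterlim (\<lambda>k. 1 / real (Suc k)) (at 0) sequentially"
      unfolding filterlim_at using LIMSEQ_inverse_real_of_nat
      by (auto simp: inverse_eq_divide)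
    ultimately have "(\<lambda>k. (F (x + (1 / Suc k) *\<^sub>R d) - F x) / (1 / Suc k)) \<longlonglongrightarrow> F' x d"
      by (rule filterlim_compose)
    then show ?thesis unfolding s_def by (intro tendsto_mult tendsto_const)
  qed
  have meas: "s k \<in> borel_measurable lborel" for k
  proof -
    have "continuous_on UNIV (s k)" unfolding s_def
      by (intro continuous_intros w Fc continuous_on_compose2[OF Fc]) auto
    then show ?thesis by (simp add: borel_measurable_continuous_onI)
  qed
  have lmeas: "(\<lambda>x. w x * F' x d) \<in> borel_measurable lborel"
    using w cont by (auto intro!: borel_measurable_continuous_onI continuous_intros)
  have dom: "integrable lborel (\<lambda>x. indicator (cball 0 R) x * (D * C))"
    by (intro integrable_mult_left integrable_real_indicator emeasure_bounded_finite) auto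
  show "integrable lborel (\<lambda>x. w x * F' x d)"
    by (rule integrable_dominated_convergence[where s = s, OF lmeas meas dom]) (use lim bound in auto)
  show "(\<lambda>k. \<integral>x. w x * ((F (x + (1 / Suc k) *\<^sub>R d) - F x) / (1 / Suc k)) \<partial>lborel)
           \<longlonglongrightarrow> (\<integral>x. w x * F' x d \<partial>lborel)"
    unfolding s_def[symmetric]
    by (rule integral_dominated_convergence[OF lmeas meas dom]) (use lim bound in auto)
qed

text \<open>
Translation invariance makes the integral of every difference quotient of \<open>F\<close> zero.
\<close>

lemma integral_directional_derivative_eq_0:
  fixes F :: "'a::euclidean_space \<Rightarrow> real"
  assumes F: "\<And>x. (F has_derivative F' x) (at x)"
    and cont: "continuous_on UNIV (\<lambda>x. F' x d)"
    and supp: "\<And>x. norm x > R \<Longrightarrow> F x = 0"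
  shows "integrable lborel (\<lambda>x. F' x d)" and "(\<integral>x. F' x d \<partial>lborel) = 0"
proof -
  have Fc: "continuous_on UNIV F"
    using F by (meson continuous_at_imp_continuous_on has_derivative_continuous)
  have far: "1 * (F (x + h *\<^sub>R d) - F x) = 0" if "norm x > R + norm d" "0 < h" "h \<le> 1" for x h
  proof -
    have "norm (h *\<^sub>R d) \<le> norm d" using that by (simp add: mult_left_le_one_le)
    then have "norm (x + h *\<^sub>R d) > R"
      using that norm_triangle_ineq4[of "x + h *\<^sub>R d" "h *\<^sub>R d"] by simp
    moreover have "norm x > R" using that(1) norm_ge_zero[of d] by linarith
    ultimately show ?thesis by (simp add: supp)
  qed
  note lim = difference_quotient_limit[where w = "\<lambda>_. 1" and R = "R + norm d",
      OF continuous_on_const F cont]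
  show "integrable lborel (\<lambda>x. F' x d)"
    using lim(1)[OF far] by simp
  have int: "integrable lborel F" by (rule integrable_continuous_bounded_support[OF Fc supp])
  have zero: "(\<integral>x. 1 * ((F (x + h *\<^sub>R d) - F x) / h) \<partial>lborel) = 0" for h
  proof -
    have "integrable lborel (\<lambda>x. F (x + h *\<^sub>R d))"
    proof (rule integrable_continuous_bounded_support[where R = "R + norm (h *\<^sub>R d)"])
      show "continuous_on UNIV (\<lambda>x. F (x + h *\<^sub>R d))"
        by (intro continuous_on_compose2[OF Fc] continuous_intros) auto
      fix x :: 'a assume "norm x > R + norm (h *\<^sub>R d)"
      then show "F (x + h *\<^sub>R d) = 0"
        using norm_triangle_ineq4[of "x + h *\<^sub>R d" "h *\<^sub>R d"] by (intro supp) simp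
    qed
    then show ?thesis
      using int lborel_integral_translate[OF borel_measurable_continuous_onI[OF Fc]] by simp
  qed
  have "(\<lambda>k::nat. 0) \<longlonglongrightarrow> (\<integral>x. 1 * F' x d \<partial>lborel)"
    using lim(2)[OF far] unfolding zero by simp
  then show "(\<integral>x. F' x d \<partial>lborel) = 0" by (simp add: LIMSEQ_const_iff)
qed

text \<open>
For smooth \<open>A\<close> this is two integrations by parts. For \<open>A\<close> of class \<open>C^1\<close>, replace the derivative of
\<open>A\<close> along \<open>d\<close> by a difference quotient: one may then integrate by parts along \<open>c\<close>, and a translation moves the
difference quotient onto \<open>f\<close>, with the opposite step.
\<close>

lemma weak_derivatives_commute:
  fixes f A :: "'a::euclidean_space \<Rightarrow> real"
  assumes f: "\<And>x. (f has_derivative f' x) (at x)"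
    and A: "\<And>x. (A has_derivative A' x) (at x)"
    and fc: "\<And>d. continuous_on UNIV (\<lambda>x. f' x d)"
    and Ac: "\<And>d. continuous_on UNIV (\<lambda>x. A' x d)"
    and supp: "\<And>x. norm x > R \<Longrightarrow> f x = 0"
  shows "integrable lborel (\<lambda>x. f' x c * A' x d)"
    and "(\<integral>x. f' x c * A' x d \<partial>lborel) = (\<integral>x. f' x d * A' x c \<partial>lborel)"
proof -
  have fcont: "continuous_on UNIV f" and Acont: "continuous_on UNIV A"
    using f A by (meson continuous_at_imp_continuous_on has_derivative_continuous)+
  have fsupp': "f' x d = 0" if "norm x > R" for x d
  proof -
    have "(f has_derivative (\<lambda>_. 0)) (at x)"
    proof (rule has_derivative_transform_within_open[OF has_derivative_const[of 0]])
      show "open {x. norm x > R}" by (intro open_Collect_less continuous_intros)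
    qed (use that supp in auto)
    then show ?thesis using has_derivative_unique[OF f] by metis
  qed
  note l1 = difference_quotient_limit[where w = "\<lambda>x. f' x c" and R = R, OF fc A Ac]
  show int: "integrable lborel (\<lambda>x. f' x c * A' x d)"
    by (rule l1(1)) (use fsupp' in auto)
  have lim1: "(\<lambda>k. \<integral>x. f' x c * ((A (x + (1 / Suc k) *\<^sub>R d) - A x) / (1 / Suc k)) \<partial>lborel)
           \<longlonglongrightarrow> (\<integral>x. f' x c * A' x d \<partial>lborel)"
    by (rule l1(2)) (use fsupp' in auto)
  have far: "norm (x + h *\<^sub>R e) > R" if "norm x > R + \<bar>h\<bar> * norm e" for x e :: 'a and h
    using that norm_triangle_ineq4[of "x + h *\<^sub>R e" "h *\<^sub>R e"] by simp
  have lim2: "(\<lambda>k. \<integral>x. A' x c * ((f (x + (1 / Suc k) *\<^sub>R (-d)) - f x) / (1 / Suc k)) \<partial>lborel)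
           \<longlonglongrightarrow> (\<integral>x. A' x c * f' x (-d) \<partial>lborel)"
  proof (rule difference_quotient_limit(2)[where R = "R + norm d", OF Ac f fc])
    fix x :: 'a and h :: real assume h: "R + norm d < norm x" "0 < h" "h \<le> 1"
    have "h * norm d \<le> norm d" using h by (simp add: mult_left_le_one_le)
    then have "f (x + h *\<^sub>R - d) = 0" "f x = 0"
      using h far[where e = "-d" and h = h and x = x] norm_ge_zero[of d]
      by (intro supp; simp; linarith)+
    then show "A' x c * (f (x + h *\<^sub>R - d) - f x) = 0" by simp
  qed
  have eq: "(\<integral>x. f' x c * ((A (x + h *\<^sub>R d) - A x) / h) \<partial>lborel)
      = - (\<integral>x. A' x c * ((f (x + h *\<^sub>R (-d)) - f x) / h) \<partial>lborel)" if "h > 0" for h :: real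
  proof -
    have dd: "((\<lambda>x. f x * (A (x + h *\<^sub>R d) - A x)) has_derivative
        (\<lambda>u. f x * (A' (x + h *\<^sub>R d) u - A' x u) + f' x u * (A (x + h *\<^sub>R d) - A x))) (at x)" for x
    proof -
      have "((\<lambda>x. A (x + h *\<^sub>R d)) has_derivative (\<lambda>u. A' (x + h *\<^sub>R d) u)) (at x)"
        by (rule has_derivative_compose[OF _ A]) (auto intro!: derivative_eq_intros)
      then show ?thesis using f A by (intro has_derivative_mult has_derivative_diff) auto
    qed
    have Ash: "continuous_on UNIV (\<lambda>x. A' (x + h *\<^sub>R d) u)" for u
      by (intro continuous_on_compose2[OF Ac[of u]] continuous_intros) auto
    have Ash0: "continuous_on UNIV (\<lambda>x. A (x + h *\<^sub>R d))"
      by (intro continuous_on_compose2[OF Acont] continuous_intros) auto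
    have i1: "integrable lborel (\<lambda>x. f' x c * (A (x + h *\<^sub>R d) - A x))"
      by (rule integrable_continuous_bounded_support[where R = R])
        (use fsupp' in \<open>auto intro!: continuous_intros fc Ash0 Acont\<close>)
    have i2: "integrable lborel (\<lambda>x. f x * A' (x + h *\<^sub>R d) c)"
      by (rule integrable_continuous_bounded_support[where R = R])
        (use supp in \<open>auto intro!: continuous_intros Ash fcont\<close>)
    have i3: "integrable lborel (\<lambda>x. f x * A' x c)"
      by (rule integrable_continuous_bounded_support[where R = R])
        (use supp in \<open>auto intro!: continuous_intros Ac fcont\<close>)
    have "continuous_on UNIV (\<lambda>x. f (x - h *\<^sub>R d))"
      by (intro continuous_on_compose2[OF fcont] continuous_intros) auto
    then have i4: "integrable lborel (\<lambda>x. f (x - h *\<^sub>R d) * A' x c)"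
      by (intro integrable_continuous_bounded_support[where R = "R + \<bar>h\<bar> * norm d"])
        (use far[where e = "-d"] supp in \<open>auto intro!: continuous_intros Ac\<close>)
    have "(\<integral>x. f x * (A' (x + h *\<^sub>R d) c - A' x c) + f' x c * (A (x + h *\<^sub>R d) - A x) \<partial>lborel) = 0"
      by (rule integral_directional_derivative_eq_0(2)[OF dd, where R = R])
        (use supp in \<open>auto intro!: continuous_intros fcont fc Ac Acont Ash Ash0\<close>)
    then have *: "(\<integral>x. f x * A' (x + h *\<^sub>R d) c \<partial>lborel) - (\<integral>x. f x * A' x c \<partial>lborel)
        + (\<integral>x. f' x c * (A (x + h *\<^sub>R d) - A x) \<partial>lborel) = 0"
      using i1 i2 i3 by (simp add: right_diff_distrib)
    have "(\<lambda>x. f (x - h *\<^sub>R d) * A' x c) \<in> borel_measurable borel"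
      using borel_measurable_integrable[OF i4] by simp
    from lborel_integral_translate[OF this, of "h *\<^sub>R d"]
    have "(\<integral>x. f x * A' (x + h *\<^sub>R d) c \<partial>lborel) = (\<integral>x. f (x - h *\<^sub>R d) * A' x c \<partial>lborel)"
      by simp
    then have "(\<integral>x. f' x c * (A (x + h *\<^sub>R d) - A x) \<partial>lborel)
        = - (\<integral>x. (f (x - h *\<^sub>R d) - f x) * A' x c \<partial>lborel)"
      using * i3 i4 by (simp add: left_diff_distrib)
    then show ?thesis using that by (simp add: mult.commute)
  qed
  have lim3: "(\<lambda>k. \<integral>x. f' x c * ((A (x + (1 / Suc k) *\<^sub>R d) - A x) / (1 / Suc k)) \<partial>lborel)
           \<longlonglongrightarrow> - (\<integral>x. A' x c * f' x (-d) \<partial>lborel)"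
    using tendsto_minus[OF lim2] by (subst eq) auto
  have "f' x (-d) = - f' x d" for x
    using has_derivative_linear[OF f] by (simp add: linear_neg)
  then have "(\<integral>x. A' x c * f' x (-d) \<partial>lborel) = - (\<integral>x. f' x d * A' x c \<partial>lborel)"
    by (simp add: mult.commute)
  then show "(\<integral>x. f' x c * A' x d \<partial>lborel) = (\<integral>x. f' x d * A' x c \<partial>lborel)"
    using LIMSEQ_unique[OF lim1 lim3] by simp
qed

section \<open>Gradient and Hessian of twice continuously differentiable functions\<close>

definition hess :: "(real ^ 'n::finite \<Rightarrow> real) \<Rightarrow> real ^ 'n \<Rightarrow> real ^ 'n ^ 'n" where
  "hess f x = (\<chi> i. grad (partial_deriv i f) x)"

lemma has_derivative_grad:
  fixes f :: "real ^ 'n::finite \<Rightarrow> real"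
  assumes "f differentiable (at x)"
  shows "(f has_derivative (\<lambda>u. grad f x \<bullet> u)) (at x)"
proof -
  let ?D = "frechet_derivative f (at x)"
  have D: "(f has_derivative ?D) (at x)" using assms by (simp add: frechet_derivative_works)
  have "?D u = grad f x \<bullet> u" for u
  proof -
    have "?D u = ?D (\<Sum>i\<in>UNIV. (u $ i) *\<^sub>R axis i 1)"
      using basis_expansion[of u] by (simp add: scalar_mult_eq_scaleR)
    also have "\<dots> = (\<Sum>i\<in>UNIV. u $ i * ?D (axis i 1))"
      using has_derivative_linear[OF D] by (simp add: linear_sum linear_scale)
    finally show ?thesis
      by (simp add: grad_def partial_deriv_def inner_vec_def mult.commute)
  qed
  then have "?D = (\<lambda>u. grad f x \<bullet> u)" by (rule ext)
  with D show ?thesis by simp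
qed

lemma grad_nth: "grad f x $ i = partial_deriv i f x"
  by (simp add: grad_def)

lemma laplacian_eq_trace_hess: "laplacian f x = (\<Sum>i\<in>UNIV. hess f x $ i $ i)"
  by (simp add: laplacian_def hess_def grad_nth)

lemma C2_fun_D1:
  assumes "C2_fun v"
  shows "(v has_derivative (\<lambda>u. grad v x \<bullet> u)) (at x)"
  using assms by (intro has_derivative_grad) (simp add: C2_fun_def differentiable_on_def)

lemma C2_fun_D2:
  assumes "C2_fun v"
  shows "((\<lambda>x. grad v x $ i) has_derivative (\<lambda>u. hess v x $ i \<bullet> u)) (at x)"
  using assms unfolding hess_def grad_nth vec_lambda_beta
  by (intro has_derivative_grad) (simp add: C2_fun_def differentiable_on_def)

lemma C2_fun_continuous_hess:
  assumes "C2_fun v" shows "continuous_on UNIV (\<lambda>x. hess v x $ i $ j)"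
  using assms by (simp add: hess_def grad_nth C2_fun_def)

lemma C2_fun_continuous_grad_nth:
  assumes "C2_fun v" shows "continuous_on UNIV (\<lambda>x. grad v x $ i)"
  using C2_fun_D2[OF assms] by (meson continuous_at_imp_continuous_on has_derivative_continuous)

lemma C2_fun_continuous_grad:
  assumes "C2_fun v" shows "continuous_on UNIV (grad v)"
proof -
  have "continuous_on UNIV (\<lambda>x. \<chi> i. grad v x $ i)"
    by (intro continuous_on_vec_lambda C2_fun_continuous_grad_nth assms)
  then show ?thesis by simp
qed

lemma C2_fun_continuous:
  assumes "C2_fun v" shows "continuous_on UNIV v"
  using C2_fun_D1[OF assms] by (meson continuous_at_imp_continuous_on has_derivative_continuous)

lemma has_derivative_grad_vec:
  assumes "C2_fun v"
  shows "(grad v has_derivative (\<lambda>u. hess v x *v u)) (at x)"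
proof -
  have "((\<lambda>x. grad v x \<bullet> b) has_derivative (\<lambda>u. (hess v x *v u) \<bullet> b)) (at x)" if b: "b \<in> Basis" for b
  proof -
    obtain i where "b = axis i 1" using b by (auto simp: Basis_vec_def)
    then show ?thesis using C2_fun_D2[OF assms, of i x]
      by (simp add: inner_axis matrix_vector_mul_component)
  qed
  then show ?thesis by (subst has_derivative_componentwise_within) auto
qed

section \<open>Cutoff functions\<close>

text \<open>
At the kink the difference quotient is bounded by \<open>|h|^(k-1)\<close>, hence the exponent at least 2.
\<close>

lemma DERIV_pos_part_power:
  fixes s :: real
  assumes k: "k \<ge> 2"
  shows "((\<lambda>s. max 0 s ^ k) has_real_derivative of_nat k * max 0 s ^ (k - 1)) (at s)"
proof -
  consider "s > 0" | "s < 0" | "s = 0" by linarith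
  then show ?thesis
  proof cases
    case 1
    have "((\<lambda>s. s ^ k) has_real_derivative of_nat k * s ^ (k - 1)) (at s)"
      by (auto intro!: derivative_eq_intros)
    then have "((\<lambda>s. max 0 s ^ k) has_real_derivative of_nat k * s ^ (k - 1)) (at s)"
      by (rule has_field_derivative_transform_within_open[of _ _ _ "{0<..}"]) (use 1 in auto)
    then show ?thesis using 1 by simp
  next
    case 2
    have "((\<lambda>s. max 0 s ^ k) has_real_derivative 0) (at s)"
      by (rule has_field_derivative_transform_within_open[of "\<lambda>_. 0" _ _ "{..<0}"])
        (use 2 k in auto)
    then show ?thesis using 2 k by (simp add: zero_power)
  next
    case 3
    have "((\<lambda>h. max 0 h ^ k / h) \<longlongrightarrow> 0) (at (0::real))"
    proof (rule Lim_null_comparison)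
      have "norm (max 0 h ^ k / h) \<le> \<bar>h\<bar> ^ (k - 1)" for h :: real
      proof (cases "h > 0")
        case True
        then show ?thesis using k by (simp add: power_diff)
      qed (use k in \<open>auto simp: zero_power\<close>)
      then show "\<forall>\<^sub>F h in at 0. norm (max 0 h ^ k / h) \<le> \<bar>h::real\<bar> ^ (k - 1)" by simp
      have "((\<lambda>h::real. \<bar>h\<bar> ^ (k - 1)) \<longlongrightarrow> \<bar>0\<bar> ^ (k - 1)) (at 0)"
        by (intro tendsto_intros)
      moreover have "\<bar>0 :: real\<bar> ^ (k - 1) = 0" using k by (simp add: zero_power)
      ultimately show "((\<lambda>h::real. \<bar>h\<bar> ^ (k - 1)) \<longlongrightarrow> 0) (at 0)" by metis
    qed
    then show ?thesis using 3 k by (simp add: DERIV_def zero_power)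
  qed
qed

text \<open>
A cutoff whose powers have explicit gradients: the gradient of \<open>bump c R x ^ k\<close> has norm at most
\<open>2k/R * bump c R x ^ (k - 1)\<close>.
\<close>

definition bump :: "'a::euclidean_space \<Rightarrow> real \<Rightarrow> 'a \<Rightarrow> real" where
  "bump c R x = max 0 (1 - (norm (x - c))\<^sup>2 / R\<^sup>2)"

lemma bump_range: "0 \<le> bump c R x" "bump c R x \<le> 1"
  by (auto simp: bump_def)

lemma bump_eq_0: "R > 0 \<Longrightarrow> norm (x - c) \<ge> R \<Longrightarrow> bump c R x = 0"
  by (simp add: bump_def power_mono)

lemma bump_ge: "R > 0 \<Longrightarrow> norm (x - c) \<le> R / 2 \<Longrightarrow> bump c R x \<ge> 3 / 4"
  using power_mono[of "norm (x - c)" "R / 2" 2]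
  by (auto simp: bump_def field_simps power2_eq_square le_max_iff_disj)

lemma continuous_bump: "continuous_on S (bump c R)"
  unfolding bump_def by (cases "R = 0") (auto intro!: continuous_intros)

lemma has_derivative_bump_power:
  fixes c :: "'a::euclidean_space"
  assumes "k \<ge> 2" "R > 0"
  shows "((\<lambda>x. bump c R x ^ k) has_derivative
      (\<lambda>u. (- (2 * real k / R\<^sup>2 * bump c R x ^ (k - 1)) *\<^sub>R (x - c)) \<bullet> u)) (at x)"
proof -
  have eq: "1 - (norm (x - c))\<^sup>2 / R\<^sup>2 = 1 - inverse (R\<^sup>2) * ((x - c) \<bullet> (x - c))" for x
    by (simp add: power2_norm_eq_inner divide_inverse mult.commute)
  have "((\<lambda>x. 1 - inverse (R\<^sup>2) * ((x - c) \<bullet> (x - c))) has_derivative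
      (\<lambda>u. - (inverse (R\<^sup>2) * (2 * ((x - c) \<bullet> u))))) (at x)"
    by (auto intro!: derivative_eq_intros simp: inner_commute)
  from has_derivative_compose[OF this DERIV_pos_part_power[OF assms(1), unfolded has_field_derivative_def]]
  have "((\<lambda>x. bump c R x ^ k) has_derivative (\<lambda>u. real k * bump c R x ^ (k - 1)
      * (- (inverse (R\<^sup>2) * (2 * ((x - c) \<bullet> u)))))) (at x)"
    unfolding bump_def eq .
  moreover have "real k * bump c R x ^ (k - 1) * (- (inverse (R\<^sup>2) * (2 * ((x - c) \<bullet> u))))
      = (- (2 * real k / R\<^sup>2 * bump c R x ^ (k - 1)) *\<^sub>R (x - c)) \<bullet> u" for u
    by (simp add: inner_scaleR_left divide_inverse)
  ultimately show ?thesis by simp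
qed

lemma continuous_bump_grad:
  fixes c :: "'a::euclidean_space"
  shows "continuous_on UNIV (\<lambda>x. - (2 * real k / R\<^sup>2 * bump c R x ^ (k - 1)) *\<^sub>R (x - c))"
  by (intro continuous_intros continuous_bump)

lemma integral_ge_on_ball:
  fixes f :: "'a::euclidean_space \<Rightarrow> real"
  assumes "integrable lborel f" "\<And>x. f x \<ge> 0" "\<And>x. x \<in> ball a r \<Longrightarrow> f x \<ge> c"
  shows "(\<integral>x. f x \<partial>lborel) \<ge> c * measure lborel (ball a r)"
proof -
  have i: "integrable lborel (\<lambda>x. c * indicator (ball a r) x :: real)"
    by (intro integrable_mult_right integrable_real_indicator emeasure_bounded_finite) auto
  have "(\<integral>x. c * indicator (ball a r) x \<partial>lborel) \<le> (\<integral>x. f x \<partial>lborel)"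
    by (rule integral_mono[OF i assms(1)]) (use assms in \<open>auto simp: indicator_def\<close>)
  then show ?thesis by simp
qed

section \<open>Green's formula and the weak Bochner formula\<close>

text \<open>
The integrand is the divergence of \<open>\<psi> grad v\<close>.
\<close>

lemma integral_green:
  fixes v \<psi> :: "real ^ 'n::finite \<Rightarrow> real"
  assumes v: "C2_fun v"
    and psi: "\<And>x. (\<psi> has_derivative (\<lambda>u. D x \<bullet> u)) (at x)" "continuous_on UNIV D"
    and supp: "\<And>x. norm x > R \<Longrightarrow> \<psi> x = 0"
  shows "integrable lborel (\<lambda>x. \<psi> x * laplacian v x + D x \<bullet> grad v x)"
    and "(\<integral>x. \<psi> x * laplacian v x + D x \<bullet> grad v x \<partial>lborel) = 0"
proof -
  have pc: "continuous_on UNIV \<psi>"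
    using psi(1) by (meson continuous_at_imp_continuous_on has_derivative_continuous)
  let ?f = "\<lambda>i x. \<psi> x * (hess v x $ i \<bullet> axis i 1) + (D x \<bullet> axis i 1) * grad v x $ i"
  have d: "((\<lambda>x. \<psi> x * grad v x $ i) has_derivative
      (\<lambda>u. \<psi> x * (hess v x $ i \<bullet> u) + (D x \<bullet> u) * grad v x $ i)) (at x)" for i x
    by (rule has_derivative_mult[OF psi(1) C2_fun_D2[OF v]])
  have Dn: "continuous_on UNIV (\<lambda>x. D x $ i)" for i
    using psi(2) by (intro continuous_intros)
  have c: "continuous_on UNIV (?f i)" for i
    unfolding inner_axis
    by (simp, intro continuous_intros pc Dn C2_fun_continuous_grad_nth C2_fun_continuous_hess v)
  note z = integral_directional_derivative_eq_0[OF d c, where R = R]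
  have i: "integrable lborel (?f i)" and z: "(\<integral>x. ?f i x \<partial>lborel) = 0" for i
    using z[of i] supp by auto
  have eq: "\<psi> x * laplacian v x + D x \<bullet> grad v x = (\<Sum>i\<in>UNIV. ?f i x)" for x
    by (simp add: laplacian_eq_trace_hess sum.distrib sum_distrib_left inner_axis inner_vec_def[of "D x" "grad v x"])
  show "integrable lborel (\<lambda>x. \<psi> x * laplacian v x + D x \<bullet> grad v x)"
    unfolding eq by (intro Bochner_Integration.integrable_sum i)
  show "(\<integral>x. \<psi> x * laplacian v x + D x \<bullet> grad v x \<partial>lborel) = 0"
    unfolding eq using i z by (subst Bochner_Integration.integral_sum) auto
qed

text \<open>
Schwarz's theorem, in weak form: integrating by parts, a test function pairs with the difference of
the two mixed derivatives to zero because its own derivatives commute weakly with those of \<open>v\<close>. A bump placed where the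
difference is positive gives a contradiction.
\<close>

lemma hess_symmetric:
  fixes v :: "real ^ 'n::finite \<Rightarrow> real"
  assumes v: "C2_fun v"
  shows "hess v x $ i $ j = hess v x $ j $ i"
proof -
  have "\<not> hess v a $ i $ j > hess v a $ j $ i" for a i j
  proof
    assume gt: "hess v a $ i $ j > hess v a $ j $ i"
    define z where "z x = hess v x $ i $ j - hess v x $ j $ i" for x
    define e where "e = z a / 2"
    have e: "e > 0" using gt by (simp add: e_def z_def)
    have zc: "continuous_on UNIV z" unfolding z_def
      by (intro continuous_intros C2_fun_continuous_hess v)
    then have "open (z -` {e<..})" by (intro open_vimage) auto
    moreover have "a \<in> z -` {e<..}" using e by (simp add: e_def)
    ultimately obtain r where r: "r > 0" "ball a r \<subseteq> z -` {e<..}"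
      by (meson open_contains_ball)
    define \<psi> where "\<psi> x = bump a r x ^ 2" for x
    define D where "D x = - (2 * real 2 / r\<^sup>2 * bump a r x ^ (2 - 1)) *\<^sub>R (x - a)" for x
    have psi: "(\<psi> has_derivative (\<lambda>u. D x \<bullet> u)) (at x)" for x
      unfolding \<psi>_def D_def by (rule has_derivative_bump_power) (use r in auto)
    have Dc: "continuous_on UNIV D" unfolding D_def by (rule continuous_bump_grad)
    have pc: "continuous_on UNIV \<psi>" unfolding \<psi>_def by (intro continuous_intros continuous_bump)
    have out: "\<psi> x = 0" if "x \<notin> ball a r" for x
      using that r by (simp add: \<psi>_def bump_eq_0 dist_norm norm_minus_commute)
    have supp: "\<psi> x = 0" if "norm x > norm a + r" for x
      using that norm_triangle_ineq2[of x a]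
      by (intro out) (simp add: dist_norm norm_minus_commute)
    have ibp: "integrable lborel (\<lambda>x. \<psi> x * (hess v x $ k $ l) + D x $ l * grad v x $ k)"
         "(\<integral>x. \<psi> x * (hess v x $ k $ l) + D x $ l * grad v x $ k \<partial>lborel) = 0" for k l
    proof -
      have d: "((\<lambda>x. \<psi> x * grad v x $ k) has_derivative
        (\<lambda>u. \<psi> x * (hess v x $ k \<bullet> u) + (D x \<bullet> u) * grad v x $ k)) (at x)" for x
        by (rule has_derivative_mult[OF psi C2_fun_D2[OF v]])
      have c: "continuous_on UNIV (\<lambda>x. \<psi> x * (hess v x $ k \<bullet> axis l 1) + (D x \<bullet> axis l 1) * grad v x $ k)"
        unfolding inner_axis
        by (simp, intro continuous_intros pc Dc C2_fun_continuous_grad_nth C2_fun_continuous_hess v)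
      note z = integral_directional_derivative_eq_0[OF d c, where R = "norm a + r"]
      show "integrable lborel (\<lambda>x. \<psi> x * (hess v x $ k $ l) + D x $ l * grad v x $ k)"
         "(\<integral>x. \<psi> x * (hess v x $ k $ l) + D x $ l * grad v x $ k \<partial>lborel) = 0"
        using z supp by (simp_all add: inner_axis)
    qed
    have comm: "integrable lborel (\<lambda>x. D x $ k * grad v x $ l)"
      "(\<integral>x. D x $ k * grad v x $ l \<partial>lborel) = (\<integral>x. D x $ l * grad v x $ k \<partial>lborel)" for k l
    proof -
      have c: "continuous_on UNIV (\<lambda>x. D x \<bullet> u)" "continuous_on UNIV (\<lambda>x. grad v x \<bullet> u)" for u
        by (intro continuous_intros Dc C2_fun_continuous_grad v)+
      note w = weak_derivatives_commute[OF psi C2_fun_D1[OF v] c, where R = "norm a + r"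
          and c = "axis k 1" and d = "axis l 1"]
      show "integrable lborel (\<lambda>x. D x $ k * grad v x $ l)"
        "(\<integral>x. D x $ k * grad v x $ l \<partial>lborel) = (\<integral>x. D x $ l * grad v x $ k \<partial>lborel)"
        using w supp by (simp_all add: inner_axis)
    qed
    have ih: "integrable lborel (\<lambda>x. \<psi> x * hess v x $ k $ l)" for k l
      using Bochner_Integration.integrable_diff[OF ibp(1)[of k l] comm(1)[of l k]] by simp
    have "(\<integral>x. \<psi> x * hess v x $ i $ j \<partial>lborel) = (\<integral>x. \<psi> x * hess v x $ j $ i \<partial>lborel)"
      using ibp(2)[of i j] ibp(2)[of j i] comm(2)[of i j] ih comm(1) by simp
    then have "(\<integral>x. \<psi> x * z x \<partial>lborel) = 0"
      using ih by (simp add: z_def right_diff_distrib)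
    moreover have "(\<integral>x. \<psi> x * z x \<partial>lborel) \<ge> (9 / 16 * e) * measure lborel (ball a (r / 2))"
    proof (rule integral_ge_on_ball)
      show "integrable lborel (\<lambda>x. \<psi> x * z x)"
        using ih by (simp add: z_def right_diff_distrib)
      show "0 \<le> \<psi> x * z x" for x
        using r(2) e out[of x] by (cases "x \<in> ball a r") (auto simp: \<psi>_def)
      fix x assume x: "x \<in> ball a (r / 2)"
      have "bump a r x \<ge> 3 / 4"
        using x r(1) by (intro bump_ge) (auto simp: dist_norm norm_minus_commute)
      then have "\<psi> x \<ge> (3/4)^2" unfolding \<psi>_def by (intro power_mono) auto
      moreover have "x \<in> ball a r" using x zero_le_dist[of a x] by (simp, linarith)
      then have "z x \<ge> e" using r(2) by auto
      ultimately show "9 / 16 * e \<le> \<psi> x * z x"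
        using e by (intro mult_mono) (auto simp: power2_eq_square \<psi>_def)
    qed
    moreover have "measure lborel (ball a (r / 2)) > 0"
      using r by (simp add: content_ball_pos)
    ultimately show False using e by (simp add: mult_le_0_iff)
  qed
  then show ?thesis by (meson linorder_cases)
qed

text \<open>
For \<open>v\<close> of class \<open>C^3\<close> the integrand is the divergence of \<open>\<psi> (D^2 v grad v - \<Delta>v grad v)\<close>, in which
the third derivatives cancel. For each pair of indices \<open>i, j\<close> the contribution is a commutator of weak
derivatives of \<open>\<psi> v\<^sub>j\<close> and \<open>v\<^sub>i\<close>, and this makes sense for \<open>v\<close> of class \<open>C^2\<close>.
\<close>

lemma integral_bochner:
  fixes v \<psi> :: "real ^ 'n::finite \<Rightarrow> real"
  assumes v: "C2_fun v"
    and psi: "\<And>x. (\<psi> has_derivative (\<lambda>u. D x \<bullet> u)) (at x)" "continuous_on UNIV D"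
    and supp: "\<And>x. norm x > R \<Longrightarrow> \<psi> x = 0"
  defines "S \<equiv> \<lambda>x. \<psi> x * ((\<Sum>i\<in>UNIV. \<Sum>j\<in>UNIV. (hess v x $ i $ j)\<^sup>2) - (laplacian v x)\<^sup>2)
              + D x \<bullet> (hess v x *v grad v x - laplacian v x *\<^sub>R grad v x)"
  shows "integrable lborel S" and "(\<integral>x. S x \<partial>lborel) = 0"
proof -
  have pc: "continuous_on UNIV \<psi>"
    using psi(1) by (meson continuous_at_imp_continuous_on has_derivative_continuous)
  let ?H = "hess v" and ?g = "grad v"
  let ?f = "\<lambda>i j x. (\<psi> x * ?H x $ j $ i + D x $ i * ?g x $ j) * ?H x $ i $ j
     - (\<psi> x * ?H x $ j $ j + D x $ j * ?g x $ j) * ?H x $ i $ i"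
  have fij: "integrable lborel (?f i j) \<and> (\<integral>x. ?f i j x \<partial>lborel) = 0" for i j
  proof -
    have d: "((\<lambda>x. \<psi> x * ?g x $ j) has_derivative
        (\<lambda>u. \<psi> x * (?H x $ j \<bullet> u) + (D x \<bullet> u) * ?g x $ j)) (at x)" for x
      by (rule has_derivative_mult[OF psi(1) C2_fun_D2[OF v]])
    have Hc: "continuous_on UNIV (\<lambda>x. ?H x $ k)" for k
    proof -
      have "continuous_on UNIV (\<lambda>x. \<chi> l. ?H x $ k $ l)"
        by (intro continuous_on_vec_lambda C2_fun_continuous_hess v)
      then show ?thesis by simp
    qed
    have c1: "continuous_on UNIV (\<lambda>x. \<psi> x * (?H x $ j \<bullet> u) + (D x \<bullet> u) * ?g x $ j)" for u
      by (intro continuous_intros pc psi(2) C2_fun_continuous_grad_nth v Hc)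
    have c2: "continuous_on UNIV (\<lambda>x. ?H x $ i \<bullet> u)" for u
      by (intro continuous_intros Hc)
    have s: "\<psi> x * ?g x $ j = 0" if "norm x > R" for x using supp[OF that] by simp
    note w = weak_derivatives_commute[OF d C2_fun_D2[OF v, where i = i] c1 c2, where R = R]
    have "integrable lborel (\<lambda>x. (\<psi> x * ?H x $ j $ k + D x $ k * ?g x $ j) * ?H x $ i $ l)" for k l
      using w(1)[where c = "axis k 1" and d = "axis l 1"] s by (simp add: inner_axis)
    moreover have "(\<integral>x. (\<psi> x * ?H x $ j $ i + D x $ i * ?g x $ j) * ?H x $ i $ j \<partial>lborel)
      = (\<integral>x. (\<psi> x * ?H x $ j $ j + D x $ j * ?g x $ j) * ?H x $ i $ i \<partial>lborel)"
      using w(2)[where c = "axis i 1" and d = "axis j 1"] s by (simp add: inner_axis)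
    ultimately show ?thesis by simp
  qed
  have eq: "S x = (\<Sum>i\<in>UNIV. \<Sum>j\<in>UNIV. ?f i j x)" for x
  proof -
    have "?f i j x = \<psi> x * (?H x $ i $ j)\<^sup>2 + D x $ i * (?H x $ i $ j * ?g x $ j)
        - \<psi> x * (?H x $ i $ i * ?H x $ j $ j) - ?H x $ i $ i * (D x $ j * ?g x $ j)" for i j
      using hess_symmetric[OF v, of x i j] by (simp add: algebra_simps power2_eq_square)
    then have "(\<Sum>i\<in>UNIV. \<Sum>j\<in>UNIV. ?f i j x) =
       (\<Sum>i\<in>UNIV. \<Sum>j\<in>UNIV. \<psi> x * (?H x $ i $ j)\<^sup>2) + (\<Sum>i\<in>UNIV. \<Sum>j\<in>UNIV. D x $ i * (?H x $ i $ j * ?g x $ j))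
       - (\<Sum>i\<in>UNIV. \<Sum>j\<in>UNIV. \<psi> x * (?H x $ i $ i * ?H x $ j $ j))
       - (\<Sum>i\<in>UNIV. \<Sum>j\<in>UNIV. ?H x $ i $ i * (D x $ j * ?g x $ j))"
      by (simp add: sum.distrib sum_subtractf)
    also have "(\<Sum>i\<in>UNIV. \<Sum>j\<in>UNIV. \<psi> x * (?H x $ i $ j)\<^sup>2) = \<psi> x * (\<Sum>i\<in>UNIV. \<Sum>j\<in>UNIV. (?H x $ i $ j)\<^sup>2)"
      by (simp add: sum_distrib_left)
    also have "(\<Sum>i\<in>UNIV. \<Sum>j\<in>UNIV. D x $ i * (?H x $ i $ j * ?g x $ j)) = D x \<bullet> (?H x *v ?g x)"
      by (simp add: inner_vec_def matrix_vector_mult_def sum_distrib_left)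
    also have "(\<Sum>i\<in>UNIV. \<Sum>j\<in>UNIV. \<psi> x * (?H x $ i $ i * ?H x $ j $ j)) = \<psi> x * (laplacian v x)\<^sup>2"
      by (simp only: laplacian_eq_trace_hess power2_eq_square sum_product) (simp only: sum_distrib_left)
    also have "(\<Sum>i\<in>UNIV. \<Sum>j\<in>UNIV. ?H x $ i $ i * (D x $ j * ?g x $ j)) = laplacian v x * (D x \<bullet> ?g x)"
      by (simp add: laplacian_eq_trace_hess inner_vec_def sum_product)
    finally have "(\<Sum>i\<in>UNIV. \<Sum>j\<in>UNIV. ?f i j x) = S x"
      by (simp add: S_def right_diff_distrib inner_diff_right)
    then show ?thesis by simp
  qed
  show "integrable lborel S" unfolding eq using fij by (intro Bochner_Integration.integrable_sum) auto
  show "(\<integral>x. S x \<partial>lborel) = 0" unfolding eq using fij by (simp add: Bochner_Integration.integral_sum)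
qed

section \<open>Positivity of superharmonic functions\<close>

text \<open>
The second derivative test along the \<open>i\<close>-th axis; \<open>h i\<close> is row \<open>i\<close> of the Hessian at \<open>a\<close>.
\<close>

lemma laplacian_nonneg_at_local_min:
  fixes f :: "real ^ 'n::finite \<Rightarrow> real"
  assumes D1: "\<And>x. (f has_derivative (\<lambda>u. g x \<bullet> u)) (at x)"
    and D2: "\<And>i. ((\<lambda>x. g x $ i) has_derivative (\<lambda>u. h i \<bullet> u)) (at a)"
    and r: "r > 0" and min: "\<And>x. dist a x < r \<Longrightarrow> f a \<le> f x"
  shows "h i $ i \<ge> 0"
proof (rule ccontr)
  assume neg: "\<not> h i $ i \<ge> 0"
  let ?p = "\<lambda>t. a + t *\<^sub>R axis i (1::real)"
  have d1: "((\<lambda>t. f (?p t)) has_real_derivative g (?p t) $ i) (at t)" for t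
  proof -
    have "((\<lambda>t. f (?p t)) has_derivative (\<lambda>s. g (?p t) \<bullet> (s *\<^sub>R axis i 1))) (at t)"
      by (rule has_derivative_compose[OF _ D1]) (auto intro!: derivative_eq_intros)
    then show ?thesis by (simp add: has_field_derivative_def inner_axis mult.commute[of _ "g _ $ i"])
  qed
  have d2: "((\<lambda>t. g (?p t) $ i) has_real_derivative h i $ i) (at 0)"
  proof -
    have "((\<lambda>t. g (?p t) $ i) has_derivative (\<lambda>s. h i \<bullet> (s *\<^sub>R axis i 1))) (at 0)"
      by (rule has_derivative_compose[where g = "\<lambda>x. g x $ i"])
        (use D2[of i] in \<open>auto intro!: derivative_eq_intros\<close>)
    then show ?thesis by (simp add: has_field_derivative_def inner_axis mult.commute[of _ "h i $ i"])
  qed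
  have near: "f (?p 0) \<le> f (?p t)" if "\<bar>t\<bar> < r" for t
    using that by (auto intro: min simp: dist_norm)
  have "g (?p 0) $ i = 0"
    by (rule DERIV_local_min[OF d1 r]) (use near in auto)
  moreover obtain d where d: "d > 0" "\<And>s. 0 < s \<Longrightarrow> s < d \<Longrightarrow> g (?p (0 + s)) $ i < g (?p 0) $ i"
    using DERIV_neg_dec_right[OF d2] neg by (auto simp: not_le)
  ultimately have lt: "g (?p s) $ i < 0" if "0 < s" "s < d" for s
    using d(2)[of s] that by simp
  define t where "t = min d r / 2"
  have t: "0 < t" "t < d" "t < r" using d r by (auto simp: t_def min_def)
  obtain s where s: "0 < s" "s < t" "f (?p t) - f (?p 0) = (t - 0) * g (?p s) $ i"
    using MVT2[OF t(1), of "\<lambda>t. f (?p t)" "\<lambda>t. g (?p t) $ i"] d1 by blast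
  then have "f (?p t) < f (?p 0)" using lt[of s] t mult_pos_neg[of t "g (?p s) $ i"] by simp
  then show False using near[of t] t by simp
qed

text \<open>
The strong minimum principle. With \<open>\<alpha> = n / r^2\<close> the Gaussian \<open>exp (- \<alpha> |x - c|^2)\<close> is strictly
subharmonic outside the ball of radius \<open>r\<close>, on which \<open>v\<close> is bounded below by continuity. A small multiple of it,
shifted to vanish on a large sphere, lies below \<open>v\<close> on the annulus between the two spheres, since
the difference cannot have a negative interior minimum.
\<close>

lemma superharmonic_positive:
  fixes v :: "real ^ 'n::finite \<Rightarrow> real"
  assumes v: "C2_fun v" and nn: "\<And>x. v x \<ge> 0" and sup: "\<And>x. laplacian v x \<le> 0"
    and pos: "v c > 0"
  shows "v y > 0"
proof -
  have vc: "continuous_on UNIV v" by (rule C2_fun_continuous[OF v])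
  obtain r where r: "r > 0" "\<And>x. dist c x \<le> r \<Longrightarrow> v x \<ge> v c / 2"
  proof -
    have "open (v -` {v c / 2<..})" by (intro open_vimage vc) auto
    then obtain r where "r > 0" "cball c r \<subseteq> v -` {v c / 2<..}"
      using pos by (force simp: open_contains_cball)
    then show ?thesis by (intro that[of r]) (auto simp: subset_iff less_imp_le)
  qed
  show ?thesis
  proof (cases "dist c y \<le> r")
    case True then show ?thesis using r(2)[of y] pos by simp
  next
    case False
    define n where "n = real CARD('n)"
    define \<alpha> where "\<alpha> = n / r\<^sup>2"
    have n: "n > 0" by (simp add: n_def)
    have al: "\<alpha> > 0" using n r by (simp add: \<alpha>_def)
    define m where "m = v c / 2"
    have m: "m > 0" using pos by (simp add: m_def)
    define R where "R = dist c y + 1"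
    define E where "E x = exp (- (\<alpha> * ((x - c) \<bullet> (x - c))))" for x
    define f where "f x = v x - m * (E x - exp (- (\<alpha> * R\<^sup>2)))" for x
    define g where "g x = grad v x + (2 * \<alpha> * m * E x) *\<^sub>R (x - c)" for x
    define h where "h x i = hess v x $ i + (2 * \<alpha> * m * E x) *\<^sub>R axis i 1
        - (4 * \<alpha>\<^sup>2 * m * E x * (x $ i - c $ i)) *\<^sub>R (x - c)" for x i
    have E1: "(E has_derivative (\<lambda>u. - (2 * \<alpha> * E x * ((x - c) \<bullet> u)))) (at x)" for x
      unfolding E_def by (auto intro!: derivative_eq_intros simp: inner_commute algebra_simps)
    have D1: "(f has_derivative (\<lambda>u. g x \<bullet> u)) (at x)" for x
    proof -
      have "(f has_derivative (\<lambda>u. grad v x \<bullet> u - m * (- (2 * \<alpha> * E x * ((x - c) \<bullet> u)) - 0))) (at x)"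
        unfolding f_def by (intro derivative_intros C2_fun_D1[OF v] E1)
      moreover have "grad v x \<bullet> u - m * (- (2 * \<alpha> * E x * ((x - c) \<bullet> u)) - 0) = g x \<bullet> u" for u
        by (simp add: g_def inner_add_left)
      ultimately show ?thesis by simp
    qed
    have D2: "((\<lambda>x. g x $ i) has_derivative (\<lambda>u. h x i \<bullet> u)) (at x)" for x i
    proof -
      have c: "((\<lambda>x. x $ i - c $ i) has_derivative (\<lambda>u. u $ i)) (at x)"
        by (auto intro!: derivative_eq_intros bounded_linear.has_derivative[OF bounded_linear_vec_nth])
      have "((\<lambda>x. grad v x $ i + 2 * \<alpha> * m * (E x * (x $ i - c $ i))) has_derivative
         (\<lambda>u. hess v x $ i \<bullet> u + 2 * \<alpha> * m * (E x * u $ i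
            + - (2 * \<alpha> * E x * ((x - c) \<bullet> u)) * (x $ i - c $ i)))) (at x)"
        by (intro has_derivative_add C2_fun_D2[OF v] has_derivative_mult_right has_derivative_mult E1 c)
      moreover have "hess v x $ i \<bullet> u + 2 * \<alpha> * m * (E x * u $ i
            + - (2 * \<alpha> * E x * ((x - c) \<bullet> u)) * (x $ i - c $ i)) = h x i \<bullet> u" for u
        by (simp add: h_def inner_add_left inner_diff_left inner_axis' algebra_simps power2_eq_square)
      ultimately show ?thesis by (simp add: g_def mult.assoc)
    qed
    define K where "K = cball c R - ball c r"
    have "compact K" unfolding K_def by (intro compact_diff) auto
    moreover have yK: "y \<in> K" using False by (auto simp: K_def R_def)
    moreover have fc: "continuous_on K f"
      using D1 by (meson continuous_at_imp_continuous_on has_derivative_continuous)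
    ultimately obtain a where a: "a \<in> K" "\<And>x. x \<in> K \<Longrightarrow> f a \<le> f x"
      using continuous_attains_inf[of K f] by blast
    have Esphere: "E x = exp (- (\<alpha> * (dist c x)\<^sup>2))" for x
      by (simp add: E_def power2_norm_eq_inner[symmetric] dist_norm norm_minus_commute)
    have "f a \<ge> 0"
    proof (rule ccontr)
      assume neg: "\<not> f a \<ge> 0"
      have "dist c a \<noteq> r"
      proof
        assume "dist c a = r"
        then have "v a \<ge> m" using r(2)[of a] by (simp add: m_def)
        moreover have "E a - exp (- (\<alpha> * R\<^sup>2)) \<le> 1"
        proof -
          have "E a \<le> 1" using al unfolding Esphere by simp
          then show ?thesis using exp_ge_zero[of "- (\<alpha> * R\<^sup>2)"] by linarith
        qed
        then have "m * (E a - exp (- (\<alpha> * R\<^sup>2))) \<le> m * 1" using m by (intro mult_left_mono) auto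
        ultimately show False using neg unfolding f_def by linarith
      qed
      moreover have "dist c a \<noteq> R"
        using neg nn[of a] by (auto simp: f_def Esphere)
      ultimately have lt: "r < dist c a" "dist c a < R" using a(1) by (auto simp: K_def)
      define \<rho> where "\<rho> = min (dist c a - r) (R - dist c a)"
      have "\<rho> > 0" using lt by (simp add: \<rho>_def)
      moreover have "f a \<le> f x" if "dist a x < \<rho>" for x
        using that dist_triangle[of c x a] dist_triangle[of c a x]
        by (intro a(2)) (auto simp: K_def \<rho>_def dist_commute)
      ultimately have "h a i $ i \<ge> 0" for i
        by (rule laplacian_nonneg_at_local_min[OF D1 D2])
      then have "(\<Sum>i\<in>UNIV. h a i $ i) \<ge> 0" by (simp add: sum_nonneg)
      also have "(\<Sum>i\<in>UNIV. h a i $ i)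
          = laplacian v a + 2 * \<alpha> * m * E a * n - 4 * \<alpha>\<^sup>2 * m * E a * (dist c a)\<^sup>2"
      proof -
        have "(dist c a)\<^sup>2 = (a - c) \<bullet> (a - c)"
          by (simp only: dist_norm norm_minus_commute[of c a] power2_norm_eq_inner)
        also have "\<dots> = (\<Sum>i\<in>UNIV. (a $ i - c $ i)\<^sup>2)"
          by (simp only: inner_vec_def vector_minus_component inner_real_def power2_eq_square)
        finally have "(dist c a)\<^sup>2 = (\<Sum>i\<in>UNIV. (a $ i - c $ i)\<^sup>2)" .
        moreover have "h a i $ i = hess v a $ i $ i + 2 * \<alpha> * m * E a
            - 4 * \<alpha>\<^sup>2 * m * E a * (a $ i - c $ i)\<^sup>2" for i
          by (simp add: h_def power2_eq_square)
        ultimately show ?thesis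
          by (simp add: laplacian_eq_trace_hess sum.distrib sum_subtractf sum_distrib_left n_def)
      qed
      finally have "2 * \<alpha> * m * E a * (2 * \<alpha> * (dist c a)\<^sup>2) \<le> 2 * \<alpha> * m * E a * n"
        using sup[of a] by (simp add: power2_eq_square algebra_simps)
      moreover have "2 * \<alpha> * m * E a > 0" using al m by (simp add: E_def)
      ultimately have "2 * \<alpha> * (dist c a)\<^sup>2 \<le> n"
        by (simp only: mult_le_cancel_left_pos)
      moreover have "\<alpha> * (dist c a)\<^sup>2 \<ge> \<alpha> * r\<^sup>2"
        using al lt r by (intro mult_left_mono power_mono) auto
      moreover have "\<alpha> * r\<^sup>2 = n" using r by (simp add: \<alpha>_def)
      ultimately show False using n by linarith
    qed
    then have "f y \<ge> 0" using a(2)[OF yK] by linarith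
    moreover have "E y > exp (- (\<alpha> * R\<^sup>2))"
    proof -
      have "(dist c y)\<^sup>2 < R\<^sup>2" by (rule power_strict_mono) (auto simp: R_def)
      then show ?thesis unfolding Esphere using al by simp
    qed
    then have "m * (E y - exp (- (\<alpha> * R\<^sup>2))) > 0" using m by simp
    ultimately show ?thesis unfolding f_def by linarith
  qed
qed

section \<open>The quadratic form\<close>

text \<open>
The left side is \<open>Q\<close> with \<open>|D^2 v|^2\<close> replaced by its lower bound. With \<open>N = 2(p+1)/(p-1)\<close> one has
\<open>k = 1/(N-1)\<close>. The coefficients come from completing the square in \<open>h\<close>. Given \<open>c3\<close>, the choice of \<open>a\<close> maximises
the resulting coefficient of \<open>X^2\<close>, which becomes \<open>(p+3)/4 \<theta> (1-\<theta>)\<close>; the coefficient of \<open>Y^2\<close> vanishes because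
\<open>(p-1)/(2(p+1)) = 1/N\<close>; and with \<open>-(p+1)/p\<close> the term in \<open>Z h\<close> is \<open>-2 Z h\<close>, for which the coefficient of
\<open>Z^2\<close> stays positive. The value of \<open>\<xi>\<close> is slightly larger than the one that the form produces; this
costs the last, nonnegative, term and makes \<open>\<xi>\<close> positive for all \<open>p > 1\<close>.
\<close>

lemma form_decomposition:
  fixes p \<theta> h X Y Z :: real
  assumes p: "p > 1"
  defines "F \<equiv> Y + Z" and "a \<equiv> - (p - 1) * \<theta> / 2" and "c3 \<equiv> - (p + 3) * \<theta> / 4"
    and "k \<equiv> (p - 1) / (p + 3)" and "L \<equiv> - (p + 1) * \<theta> * X - 2 * Z + 2 * ((p - 1) / (p + 3)) * (Y + Z)"
    and "q \<equiv> 2 * p / (p + 1)" and "\<xi> \<equiv> (p + 1) * (3 * p + 1) / (8 * p\<^sup>2)"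
    and "\<mu> \<equiv> (p - 1)\<^sup>2 / (8 * p * (p + 1))"
  shows "h\<^sup>2 + k * (F + h)\<^sup>2 - F\<^sup>2 + a * (h + F) * X + c3 * (- X * F + (a - 1) * X\<^sup>2 + 2 * X * h)
      + ((p - 1) / (2 * (p + 1)) - 1) * (- Y * F + (a + p) * X * Y)
      - (p + 1) / p * (- Z * F + a * X * Z + q * Z * h)
    = (\<theta> * X - q * Y) * ((p + 3) / 4 * (1 - \<theta>) * X - \<xi> * Z) + 6 * \<mu> * Y * Z + 8 * \<mu> * Z\<^sup>2
      + 2 * (p + 1) / (p + 3) * (h + (p + 3) / (4 * (p + 1)) * L)\<^sup>2
      + \<theta> * (p - 1)\<^sup>2 * (2 * p + 1) / (8 * p\<^sup>2) * X * Z"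
proof -
  have nz: "p \<noteq> 0" "p + 1 \<noteq> 0" "p + 3 \<noteq> 0" using p by auto
  show ?thesis unfolding assms
    using nz by (simp add: divide_simps) algebra
qed

text \<open>
The equation says that \<open>\<theta> X - q Y\<close> and \<open>A X - \<xi> Z\<close>, with \<open>A = (p+3)/4 (1-\<theta>)\<close>, vanish at the same ratio
\<open>X/Y = q/\<theta>\<close>. The left side exceeds the right side at \<open>\<theta> = 0\<close> and is smaller at \<open>\<theta> = 1\<close>.
\<close>

lemma balanced_parameter_exists:
  fixes p M :: real
  assumes p: "p > 1" and M: "M > 0"
  shows "\<exists>\<theta>. 0 < \<theta> \<and> \<theta> < 1 \<and> (p + 3) / 4 * (1 - \<theta>)
     = (p + 1) * (3 * p + 1) / (8 * p\<^sup>2) * M * (\<theta> / (2 * p / (p + 1))) powr (1 / (p + 1))"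
proof -
  define c where "c = (p + 1) * (3 * p + 1) / (8 * p\<^sup>2) * M"
  have c: "c > 0" using p M by (simp add: c_def)
  define f where "f \<theta> = c * (\<theta> / (2 * p / (p + 1))) powr (1 / (p + 1)) - (p + 3) / 4 * (1 - \<theta>)" for \<theta>
  have "continuous_on {0..1} f" unfolding f_def using p
    by (intro continuous_intros continuous_on_powr') auto
  moreover have f0: "f 0 < 0" using p by (simp add: f_def)
  moreover have f1: "f 1 > 0" using p c by (simp add: f_def)
  ultimately obtain \<theta> where "0 \<le> \<theta>" "\<theta> \<le> 1" "f \<theta> = 0"
    using IVT'[of f 0 0 1] by auto
  moreover then have "\<theta> \<noteq> 0" "\<theta> \<noteq> 1" using f0 f1 by auto
  ultimately show ?thesis unfolding f_def c_def by (intro exI[of _ \<theta>]) auto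
qed

text \<open>
The unperturbed form is nonnegative and vanishes only on the ray \<open>X = 0\<close>. Lowering the weight of the Green identity
for \<open>v^(a+p)\<close> by a small \<open>\<delta>\<close> adds \<open>\<delta> (Y^2 + Y Z - c X Y)\<close>, which is positive near that ray and, away from
it, is dominated by the form itself. Everything is homogeneous of degree two, so compactness of the segment
\<open>X + Y = 1\<close> yields the constant.
\<close>

lemma reduced_form_coercive:
  fixes p M \<theta> q \<xi> \<mu> :: real
  assumes p: "p > 1" and M: "M > 0" and th: "0 < \<theta>" "\<theta> < 1"
    and q: "q > 0" and xi: "\<xi> > 0" and mu: "\<mu> > 0" and c: "c > 0"
    and A: "A = \<xi> * M * (\<theta> / q) powr (1 / (p + 1))"
  defines "Zf \<equiv> \<lambda>X Y. M * (X powr (p / (p + 1)) * Y powr (1 / (p + 1)))"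
  shows "\<exists>\<delta>>0. \<exists>\<epsilon>>0. \<forall>X\<ge>0. \<forall>Y\<ge>0.
     (\<theta> * X - q * Y) * (A * X - \<xi> * Zf X Y) + 6 * \<mu> * Y * Zf X Y + 8 * \<mu> * (Zf X Y)\<^sup>2
       + \<delta> * (Y\<^sup>2 + Y * Zf X Y - c * X * Y) \<ge> \<epsilon> * (X + Y)\<^sup>2"
proof -
  define Q where "Q X Y = (\<theta> * X - q * Y) * (A * X - \<xi> * Zf X Y) + 6 * \<mu> * Y * Zf X Y + 8 * \<mu> * (Zf X Y)\<^sup>2" for X Y
  have sum1: "p / (p + 1) + 1 / (p + 1) = 1" using p by (simp add: field_simps)
  have split: "x powr (p / (p + 1)) * x powr (1 / (p + 1)) = x" if "x \<ge> 0" for x :: real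
    using that by (simp add: powr_add[symmetric] sum1)
  have Z0: "Zf X Y \<ge> 0" for X Y unfolding Zf_def using M by simp
  have Apos: "A > 0" using A xi M th q by simp
  have prod: "(\<theta> * X - q * Y) * (A * X - \<xi> * Zf X Y) \<ge> 0" if "X \<ge> 0" "Y \<ge> 0" for X Y
  proof -
    define x where "x = \<theta> * X / q"
    have x: "x \<ge> 0" using that th q by (simp add: x_def)
    \<comment> \<open>The balance condition makes the second factor a positive multiple of \<open>x powr \<beta> - Y powr \<beta>\<close> with \<open>\<beta> = 1/(p+1)\<close>, and
      the first one is \<open>q (x - Y)\<close>.\<close>
    have xX: "x powr (1 / (p + 1)) = (\<theta> / q) powr (1 / (p + 1)) * X powr (1 / (p + 1))"
      using that th q powr_mult[of "\<theta> / q" X] by (simp add: x_def)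
    have "A * X = A * (X powr (p / (p + 1)) * X powr (1 / (p + 1)))" using split that by simp
    also have "\<dots> = \<xi> * M * X powr (p / (p + 1)) * x powr (1 / (p + 1))"
      unfolding xX by (simp add: A mult_ac)
    finally have "A * X - \<xi> * Zf X Y = \<xi> * M * X powr (p / (p + 1)) * (x powr (1 / (p + 1)) - Y powr (1 / (p + 1)))"
      by (simp add: Zf_def algebra_simps)
    moreover have "\<theta> * X - q * Y = q * (x - Y)" using q by (simp add: x_def field_simps)
    moreover have "(x - Y) * (x powr (1 / (p + 1)) - Y powr (1 / (p + 1))) \<ge> 0"
    proof (cases "x \<le> Y")
      case True
      then have "x powr (1 / (p + 1)) \<le> Y powr (1 / (p + 1))" using x p by (intro powr_mono2) auto
      then show ?thesis using True by (intro mult_nonpos_nonpos) auto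
    next
      case False
      then have "Y powr (1 / (p + 1)) \<le> x powr (1 / (p + 1))" using that p by (intro powr_mono2) auto
      then show ?thesis using False by (intro mult_nonneg_nonneg) auto
    qed
    ultimately have "(\<theta> * X - q * Y) * (A * X - \<xi> * Zf X Y)
      = (q * \<xi> * M * X powr (p / (p + 1))) * ((x - Y) * (x powr (1 / (p + 1)) - Y powr (1 / (p + 1))))"
      and "(x - Y) * (x powr (1 / (p + 1)) - Y powr (1 / (p + 1))) \<ge> 0" by (simp_all add: mult_ac)
    then show ?thesis using q xi M by simp
  qed
  have Q0: "Q X Y \<ge> 0" if "X \<ge> 0" "Y \<ge> 0" for X Y
    using prod[OF that] Z0[of X Y] that mu by (simp add: Q_def)
  have Qpos: "Q X Y > 0" if "X > 0" "Y \<ge> 0" for X Y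
  proof (cases "Y = 0")
    case True
    then show ?thesis using that Apos th by (simp add: Q_def Zf_def)
  next
    case False
    then have "6 * \<mu> * Y * Zf X Y > 0" using that mu M by (simp add: Zf_def)
    moreover have "8 * \<mu> * (Zf X Y)\<^sup>2 \<ge> 0" using mu by simp
    ultimately show ?thesis using prod[of X Y] that unfolding Q_def by linarith
  qed
  have Zc: "continuous_on {0..1} (\<lambda>x. Zf x (1 - x))"
    unfolding Zf_def using p by (intro continuous_intros continuous_on_powr') auto
  have Qc: "continuous_on {0..1} (\<lambda>x. Q x (1 - x))"
    unfolding Q_def by (intro continuous_intros Zc)
  \<comment> \<open>On the part \<open>X < x1\<close> of the segment \<open>X + Y = 1\<close> one has \<open>2 c X < Y\<close>, so \<open>Y^2 - c X Y\<close> is positive.\<close>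
  define x1 where "x1 = 1 / (1 + 2 * c)"
  have x1: "0 < x1" "x1 < 1" using c by (auto simp: x1_def)
  obtain m where m: "m > 0" "\<And>x. x1 \<le> x \<Longrightarrow> x \<le> 1 \<Longrightarrow> Q x (1 - x) \<ge> m"
  proof -
    obtain x0 where x0: "x0 \<in> {x1..1}" "\<forall>x\<in>{x1..1}. Q x0 (1 - x0) \<le> Q x (1 - x)"
      using continuous_attains_inf[of "{x1..1}" "\<lambda>x. Q x (1 - x)"] x1 continuous_on_subset[OF Qc, of "{x1..1}"]
      by auto
    then have "Q x0 (1 - x0) > 0" using x1 by (intro Qpos) auto
    then show ?thesis using x0 by (intro that[of "Q x0 (1 - x0)"]) auto
  qed
  define \<delta> where "\<delta> = m / (2 * c)"
  have \<delta>: "\<delta> > 0" using m c by (simp add: \<delta>_def)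
  define P where "P X Y = Q X Y + \<delta> * (Y\<^sup>2 + Y * Zf X Y - c * X * Y)" for X Y
  have Ppos: "P x (1 - x) > 0" if "x \<in> {0..1}" for x
  proof (cases "x < x1")
    case True
    then have "x * (1 + 2 * c) < 1" using c by (simp add: x1_def field_simps)
    then have "c * x < 1 - x" using that c by (simp add: algebra_simps)
    moreover have "1 - x > 0" using True x1 by simp
    ultimately have "(1 - x) * ((1 - x) - c * x) > 0" by (intro mult_pos_pos) auto
    then have "(1 - x)\<^sup>2 - c * x * (1 - x) > 0" by (simp add: power2_eq_square algebra_simps)
    moreover have "(1 - x) * Zf x (1 - x) \<ge> 0" using that Z0 by simp
    ultimately have "\<delta> * ((1 - x)\<^sup>2 + (1 - x) * Zf x (1 - x) - c * x * (1 - x)) > 0"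
      using \<delta> by (intro mult_pos_pos) auto
    then show ?thesis using Q0[of x "1 - x"] that by (simp add: P_def)
  next
    case False
    then have "Q x (1 - x) \<ge> m" using m that by auto
    moreover have "x * (1 - x) \<le> 1 * 1" using that by (intro mult_mono) auto
    then have "c * x * (1 - x) \<le> c" using c by (simp add: mult.assoc)
    moreover have "(1 - x) * Zf x (1 - x) \<ge> 0" using that Z0 by simp
    ultimately have "(1 - x)\<^sup>2 + (1 - x) * Zf x (1 - x) - c * x * (1 - x) \<ge> - c"
      by (smt (verit) zero_le_power2)
    then have "\<delta> * ((1 - x)\<^sup>2 + (1 - x) * Zf x (1 - x) - c * x * (1 - x)) \<ge> \<delta> * (- c)"
      using \<delta> by (intro mult_left_mono) auto
    moreover have "\<delta> * (- c) = - m / 2" using c by (simp add: \<delta>_def)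
    ultimately show ?thesis using \<open>Q x (1 - x) \<ge> m\<close> m(1) unfolding P_def by linarith
  qed
  have Pc: "continuous_on {0..1} (\<lambda>x. P x (1 - x))"
    unfolding P_def by (intro continuous_intros Zc Qc)
  obtain \<epsilon> where e: "\<epsilon> > 0" "\<And>x. x \<in> {0..1} \<Longrightarrow> P x (1 - x) \<ge> \<epsilon>"
  proof -
    obtain x0 where "x0 \<in> {0..1}" "\<forall>x\<in>{0..1}. P x0 (1 - x0) \<le> P x (1 - x)"
      using continuous_attains_inf[of "{0..1}" "\<lambda>x. P x (1 - x)"] Pc by auto
    then show ?thesis using Ppos by (intro that[of "P x0 (1 - x0)"]) auto
  qed
  have hom: "P (s * X) (s * Y) = s\<^sup>2 * P X Y" if "s \<ge> 0" "X \<ge> 0" "Y \<ge> 0" for s X Y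
  proof -
    have "Zf (s * X) (s * Y) = s * Zf X Y"
      using that split[of s] by (simp add: Zf_def powr_mult mult_ac)
    then show ?thesis by (simp add: P_def Q_def power2_eq_square algebra_simps)
  qed
  have "P X Y \<ge> \<epsilon> * (X + Y)\<^sup>2" if "X \<ge> 0" "Y \<ge> 0" for X Y
  proof (cases "X + Y = 0")
    case True
    then have "X = 0" "Y = 0" using that by auto
    then show ?thesis by (simp add: P_def Q_def Zf_def)
  next
    case False
    define s where "s = X + Y"
    have s: "s > 0" using False that by (simp add: s_def)
    define x where "x = X / s"
    have x: "x \<in> {0..1}" "X = s * x" "Y = s * (1 - x)"
      using s that by (auto simp: x_def s_def field_simps)
    have "P X Y = s\<^sup>2 * P x (1 - x)" unfolding x(2,3) using s x(1) by (intro hom) auto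
    also have "\<dots> \<ge> s\<^sup>2 * \<epsilon>" using e(2)[OF x(1)] by (intro mult_left_mono) auto
    finally show ?thesis by (simp add: s_def mult.commute)
  qed
  then show ?thesis unfolding P_def Q_def using \<delta> e(1) by blast
qed

text \<open>
A lower bound by \<open>s^2\<close> alone yields one that includes the Hessian: the expression is also at least
\<open>u/2 - D s^2\<close>, and a multiple of the first bound compensates \<open>- D s^2\<close>.
\<close>

lemma absorb_hessian:
  fixes e C :: real
  assumes e: "e > 0" and C: "C \<ge> 0"
  obtains \<epsilon> where "\<epsilon> > 0"
    "\<And>u h l r s. h\<^sup>2 \<le> u \<Longrightarrow> \<bar>l\<bar> \<le> C * s \<Longrightarrow> - (C * s\<^sup>2) \<le> r \<Longrightarrow> e * s\<^sup>2 \<le> u + l * h + r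
       \<Longrightarrow> \<epsilon> * (u + s\<^sup>2) \<le> u + l * h + r"
proof
  define D where "D = C\<^sup>2 / 2 + C"
  have D: "D \<ge> 0" using C by (simp add: D_def)
  define k where "k = 1 + (D + 1) / e"
  have k: "k > 0" using D e by (simp add: k_def add_pos_nonneg)
  show "1 / (2 * k) > 0" using k by simp
  fix u h l r s :: real
  assume h: "h\<^sup>2 \<le> u" and l: "\<bar>l\<bar> \<le> C * s" and r: "- (C * s\<^sup>2) \<le> r" and Q: "e * s\<^sup>2 \<le> u + l * h + r"
  have "l\<^sup>2 \<le> (C * s)\<^sup>2" using power_mono[OF l, of 2] by simp
  moreover have "0 \<le> (l + h)\<^sup>2" by simp
  ultimately have "l * h \<ge> - (u / 2) - (C * s)\<^sup>2 / 2"
    using h by (simp add: power2_sum)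
  then have q1: "u + l * h + r \<ge> u / 2 - D * s\<^sup>2"
    using r by (simp add: D_def power_mult_distrib algebra_simps)
  have "(D + 1) / e * (u + l * h + r) \<ge> (D + 1) / e * (e * s\<^sup>2)"
    using Q D e by (intro mult_left_mono) auto
  then have q2: "(D + 1) / e * (u + l * h + r) \<ge> (D + 1) * s\<^sup>2" using e by simp
  define T where "T = (D + 1) / e * (u + l * h + r)"
  have "k * (u + l * h + r) = (u + l * h + r) + T"
    unfolding k_def T_def by (simp only: distrib_right mult_1)
  moreover have "T \<ge> D * s\<^sup>2 + s\<^sup>2"
    using q2 unfolding T_def by (simp only: distrib_right[of D 1 "s\<^sup>2"] mult_1)
  ultimately have "k * (u + l * h + r) \<ge> (u + s\<^sup>2) / 2"
    using q1 h zero_le_power2[of s] zero_le_power2[of h] by argo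
  then show "1 / (2 * k) * (u + s\<^sup>2) \<le> u + l * h + r"
    using k by (simp add: field_simps)
qed

text \<open>
Here \<open>u\<close> stands for \<open>|D^2 v|^2\<close>. The numbers \<open>c3\<close>, \<open>c4\<close>, \<open>c5\<close> multiply the Green identities for the
weights \<open>v^(a-1) |grad v|^2\<close>, \<open>v^(a+p)\<close>, \<open>M v^a |grad v|^q\<close>. The bound on \<open>a\<close> is what later makes the
error of the cutoff decay.
\<close>

lemma coercive_coefficients:
  fixes p M :: real
  assumes p: "p > 1" and M: "M > 0"
  obtains a c3 c4 c5 \<epsilon> where "a > - (p - 1) / 2" "\<epsilon> > 0"
    "\<And>X Y h u F Z. X \<ge> 0 \<Longrightarrow> Y \<ge> 0 \<Longrightarrow> Z = M * (X powr (p / (p + 1)) * Y powr (1 / (p + 1)))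
      \<Longrightarrow> F = Y + Z \<Longrightarrow> u \<ge> h\<^sup>2 + (p - 1) / (p + 3) * (F + h)\<^sup>2 \<Longrightarrow>
      \<epsilon> * (u + (X + Y)\<^sup>2) \<le> u - F\<^sup>2 + a * (h + F) * X + c3 * (- X * F + (a - 1) * X\<^sup>2 + 2 * X * h)
        + c4 * (- Y * F + (a + p) * X * Y) + c5 * (- Z * F + a * X * Z + 2 * p / (p + 1) * Z * h)"
proof -
  define Zf where "Zf X Y = M * (X powr (p / (p + 1)) * Y powr (1 / (p + 1)))" for X Y
  define q where "q = 2 * p / (p + 1)"
  define \<xi> where "\<xi> = (p + 1) * (3 * p + 1) / (8 * p\<^sup>2)"
  define \<mu> where "\<mu> = (p - 1)\<^sup>2 / (8 * p * (p + 1))"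
  obtain \<theta> where th: "0 < \<theta>" "\<theta> < 1"
    and bal: "(p + 3) / 4 * (1 - \<theta>) = \<xi> * M * (\<theta> / q) powr (1 / (p + 1))"
    using balanced_parameter_exists[OF p M] unfolding \<xi>_def q_def by auto
  define a where "a = - (p - 1) * \<theta> / 2"
  define c3 where "c3 = - (p + 3) * \<theta> / 4"
  have "(p - 1) * \<theta> < (p - 1) * 1" using p th by (intro mult_strict_left_mono) auto
  then have a: "a > - (p - 1) / 2" unfolding a_def by (simp add: field_simps)
  have q: "q > 0" and xi: "\<xi> > 0" and mu: "\<mu> > 0" and ap: "a + p > 0"
    using p a by (auto simp: q_def \<xi>_def \<mu>_def)
  obtain \<delta> e where de: "\<delta> > 0" "e > 0"
    and red: "\<And>X Y. X \<ge> 0 \<Longrightarrow> Y \<ge> 0 \<Longrightarrow> (\<theta> * X - q * Y) * ((p + 3) / 4 * (1 - \<theta>) * X - \<xi> * Zf X Y)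
       + 6 * \<mu> * Y * Zf X Y + 8 * \<mu> * (Zf X Y)\<^sup>2
       + \<delta> * (Y\<^sup>2 + Y * Zf X Y - (a + p) * X * Y) \<ge> e * (X + Y)\<^sup>2"
    using reduced_form_coercive[OF p M th q xi mu ap bal] unfolding Zf_def[symmetric] by blast
  define c4 where "c4 = (p - 1) / (2 * (p + 1)) - 1 - \<delta>"
  define c5 where "c5 = - ((p + 1) / p)"
  define C0 where "C0 = 4 * (1 + M)\<^sup>2 * (1 + \<bar>a\<bar> + \<bar>c3\<bar> + \<bar>c3 * (a - 1)\<bar> + \<bar>c4\<bar> + \<bar>c4 * (a + p)\<bar> + \<bar>c5\<bar> + \<bar>c5 * a\<bar>)"
  define C where "C = C0 + \<bar>a\<bar> + 2 * \<bar>c3\<bar> + \<bar>c5 * q\<bar> * M"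
  have C: "C \<ge> 0" using M by (auto simp: C_def C0_def intro!: add_nonneg_nonneg)
  obtain \<epsilon> where eps: "\<epsilon> > 0"
    "\<And>u h l r s. h\<^sup>2 \<le> u \<Longrightarrow> \<bar>l\<bar> \<le> C * s \<Longrightarrow> - (C * s\<^sup>2) \<le> r \<Longrightarrow> e * s\<^sup>2 \<le> u + l * h + r
       \<Longrightarrow> \<epsilon> * (u + s\<^sup>2) \<le> u + l * h + r"
    using absorb_hessian[OF de(2) C] by metis
  have main: "\<epsilon> * (u + (X + Y)\<^sup>2) \<le> u - F\<^sup>2 + a * (h + F) * X + c3 * (- X * F + (a - 1) * X\<^sup>2 + 2 * X * h)
         + c4 * (- Y * F + (a + p) * X * Y) + c5 * (- Z * F + a * X * Z + q * Z * h)"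
    if X: "X \<ge> 0" and Y: "Y \<ge> 0" and Z: "Z = Zf X Y" and F: "F = Y + Z"
      and u: "u \<ge> h\<^sup>2 + (p - 1) / (p + 3) * (F + h)\<^sup>2" for X Y Z F u h
  proof -
    define s where "s = X + Y"
    define W where "W = (1 + M) * s"
    have s: "s \<ge> 0" "X \<le> s" "Y \<le> s" using X Y by (auto simp: s_def)
    have Z0: "Z \<ge> 0" using M by (simp add: Z Zf_def)
    have "Z \<le> M * (s powr (p / (p + 1)) * s powr (1 / (p + 1)))"
      unfolding Z Zf_def using X Y s M p by (intro mult_left_mono mult_mono powr_mono2) auto
    also have "s powr (p / (p + 1)) * s powr (1 / (p + 1)) = s"
    proof -
      have "p / (p + 1) + 1 / (p + 1) = 1" using p by (simp add: field_simps)
      then show ?thesis using s by (simp add: powr_add[symmetric])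
    qed
    finally have Zs: "Z \<le> M * s" .
    have W: "X \<le> 2 * W" "Y \<le> 2 * W" "Z \<le> 2 * W" "F \<le> 2 * W" "W \<ge> 0" "F \<ge> 0"
      using s Zs Z0 M X Y mult_nonneg_nonneg[of M s] by (auto simp: W_def F algebra_simps)
    define l where "l = a * X + 2 * c3 * X + c5 * q * Z"
    define r where "r = - 1 * F * F + a * F * X + (- c3) * X * F + (c3 * (a - 1)) * X * X + (- c4) * Y * F
        + (c4 * (a + p)) * X * Y + (- c5) * Z * F + (c5 * a) * X * Z"
    have eq: "u - F\<^sup>2 + a * (h + F) * X + c3 * (- X * F + (a - 1) * X\<^sup>2 + 2 * X * h)
         + c4 * (- Y * F + (a + p) * X * Y) + c5 * (- Z * F + a * X * Z + q * Z * h) = u + l * h + r"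
      by (simp add: l_def r_def power2_eq_square algebra_simps)
    have b: "\<bar>c * x * y\<bar> \<le> \<bar>c\<bar> * (4 * W\<^sup>2)" if "0 \<le> x" "x \<le> 2 * W" "0 \<le> y" "y \<le> 2 * W" for c x y
    proof -
      have "x * y \<le> (2 * W) * (2 * W)" using that W by (intro mult_mono) auto
      then have "\<bar>c\<bar> * (x * y) \<le> \<bar>c\<bar> * (4 * W\<^sup>2)" by (intro mult_left_mono) (auto simp: power2_eq_square)
      then show ?thesis using that by (simp add: abs_mult mult.assoc)
    qed
    have "\<bar>r\<bar> \<le> \<bar>- 1\<bar> * (4 * W\<^sup>2) + \<bar>a\<bar> * (4 * W\<^sup>2) + \<bar>- c3\<bar> * (4 * W\<^sup>2) + \<bar>c3 * (a - 1)\<bar> * (4 * W\<^sup>2)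
        + \<bar>- c4\<bar> * (4 * W\<^sup>2) + \<bar>c4 * (a + p)\<bar> * (4 * W\<^sup>2) + \<bar>- c5\<bar> * (4 * W\<^sup>2) + \<bar>c5 * a\<bar> * (4 * W\<^sup>2)"
      unfolding r_def using X Y Z0 W by (intro order_trans[OF abs_triangle_ineq] add_mono b) auto
    also have "\<dots> = C0 * s\<^sup>2"
      unfolding C0_def W_def power_mult_distrib abs_minus_cancel by (simp add: distrib_left distrib_right mult_ac)
    also have "\<dots> \<le> C * s\<^sup>2"
      using M by (intro mult_right_mono) (auto simp: C_def)
    finally have r: "- (C * s\<^sup>2) \<le> r" by linarith
    have "\<bar>l\<bar> \<le> \<bar>a\<bar> * s + 2 * \<bar>c3\<bar> * s + \<bar>c5 * q\<bar> * (M * s)"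
      unfolding l_def using X Z0 s Zs
      by (intro order_trans[OF abs_triangle_ineq] add_mono) (auto simp: abs_mult mult.assoc intro!: mult_left_mono)
    also have "\<dots> \<le> C * s"
    proof -
      have "C0 \<ge> 0" by (auto simp: C0_def intro!: mult_nonneg_nonneg add_nonneg_nonneg)
      then have "C0 * s \<ge> 0" using s(1) by simp
      then show ?thesis by (simp add: C_def distrib_right mult.assoc)
    qed
    finally have l: "\<bar>l\<bar> \<le> C * s" .
    have k: "(p - 1) / (p + 3) * (F + h)\<^sup>2 \<ge> 0" using p by simp
    have "e * s\<^sup>2 \<le> u + l * h + r"
    proof -
      have sq: "2 * (p + 1) / (p + 3) * t\<^sup>2 \<ge> 0" for t using p by simp
      have xz: "\<theta> * (p - 1)\<^sup>2 * (2 * p + 1) / (8 * p\<^sup>2) * X * Z \<ge> 0"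
        using p th X Z0 by (intro mult_nonneg_nonneg divide_nonneg_nonneg) auto
      define R0 where "R0 = (\<theta> * X - q * Y) * ((p + 3) / 4 * (1 - \<theta>) * X - \<xi> * Z)
         + 6 * \<mu> * Y * Z + 8 * \<mu> * Z\<^sup>2"
      define P0 where "P0 = h\<^sup>2 + (p - 1) / (p + 3) * (F + h)\<^sup>2 - F\<^sup>2 + a * (h + F) * X
         + c3 * (- X * F + (a - 1) * X\<^sup>2 + 2 * X * h)
         + ((p - 1) / (2 * (p + 1)) - 1) * (- Y * F + (a + p) * X * Y)
         - (p + 1) / p * (- Z * F + a * X * Z + q * Z * h)"
      have "R0 \<le> P0" unfolding P0_def R0_def
        unfolding form_decomposition[OF p, of h Y Z \<theta> X, folded F q_def \<xi>_def \<mu>_def a_def c3_def]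
        by (intro add_increasing2 order_refl sq xz)
      have "e * s\<^sup>2 \<le> R0 + \<delta> * (Y\<^sup>2 + Y * Z - (a + p) * X * Y)"
        using red[OF X Y] unfolding Z s_def R0_def .
      also have "\<delta> * (Y\<^sup>2 + Y * Z - (a + p) * X * Y) = - \<delta> * (- Y * F + (a + p) * X * Y)"
        by (simp add: F power2_eq_square algebra_simps)
      also have "R0 + - \<delta> * (- Y * F + (a + p) * X * Y) \<le> P0 + - \<delta> * (- Y * F + (a + p) * X * Y)"
        using \<open>R0 \<le> P0\<close> by simp
      also have "\<dots> \<le> u - F\<^sup>2 + a * (h + F) * X + c3 * (- X * F + (a - 1) * X\<^sup>2 + 2 * X * h)
         + c4 * (- Y * F + (a + p) * X * Y) + c5 * (- Z * F + a * X * Z + q * Z * h)"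
        using u unfolding P0_def c4_def c5_def by (simp add: left_diff_distrib)
      finally show ?thesis unfolding eq .
    qed
    then show ?thesis unfolding eq s_def[symmetric]
      using u k by (intro eps(2) l r) auto
  qed
  show thesis
    by (rule that[OF a eps(1)]) (rule main[unfolded Zf_def q_def])
qed

section \<open>Bounds on the Hessian\<close>

text \<open>
With \<open>e\<close> the unit vector along \<open>g\<close> and \<open>h = e \<bullet> B e\<close>, expand the square norm of
\<open>B - h e e^T - c (I - e e^T)\<close> for \<open>c = k (tr B - h)\<close>. The value \<open>k = 1/(CARD('n) - 1)\<close> is optimal;
smaller \<open>k\<close> correspond to larger, not necessarily integral, dimensions. If \<open>g = 0\<close>, any unit vector will do.
\<close>

lemma hilbert_schmidt_lower_bound:
  fixes B :: "real ^ 'n::finite ^ 'n" and g :: "real ^ 'n"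
  assumes k: "k \<ge> 0" "k * (real CARD('n) - 1) \<le> 1"
  shows "\<exists>h. g \<bullet> (B *v g) = h * (g \<bullet> g) \<and>
    h\<^sup>2 + k * ((\<Sum>i\<in>UNIV. B $ i $ i) - h)\<^sup>2 \<le> (\<Sum>i\<in>UNIV. \<Sum>j\<in>UNIV. (B $ i $ j)\<^sup>2)"
proof -
  obtain e :: "real ^ 'n" where e: "norm e = 1" "g = norm g *\<^sub>R e"
  proof (cases "g = 0")
    case True then show ?thesis using that[of "axis undefined 1"] by (simp add: norm_axis_1)
  next
    case False then show ?thesis using that[of "(1 / norm g) *\<^sub>R g"] by simp
  qed
  define h where "h = e \<bullet> (B *v e)"
  define T where "T = (\<Sum>i\<in>UNIV. B $ i $ i)"
  define n where "n = real CARD('n)"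
  define c where "c = k * (T - h)"
  have ee: "(\<Sum>i\<in>UNIV. (e $ i)\<^sup>2) = 1"
    using e(1) by (simp add: norm_eq_1 inner_vec_def power2_eq_square)
  let ?d = "\<lambda>i j :: 'n. if i = j then (1::real) else 0"
  have "0 \<le> (\<Sum>i\<in>UNIV. \<Sum>j\<in>UNIV. (B $ i $ j - (h - c) * (e $ i * e $ j) - c * ?d i j)\<^sup>2)"
    by (intro sum_nonneg) auto
  also have "\<dots> = (\<Sum>i\<in>UNIV. \<Sum>j\<in>UNIV. (B $ i $ j)\<^sup>2
      + (h - c)\<^sup>2 * ((e $ i)\<^sup>2 * (e $ j)\<^sup>2) + c\<^sup>2 * ?d i j - 2 * (h - c) * (e $ i * (B $ i $ j * e $ j))
      - 2 * c * (?d i j * B $ i $ i) + 2 * (h - c) * c * (?d i j * (e $ i)\<^sup>2))"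
    by (intro sum.cong refl) (auto simp: power2_eq_square algebra_simps)
  also have "\<dots> = (\<Sum>i\<in>UNIV. \<Sum>j\<in>UNIV. (B $ i $ j)\<^sup>2)
      + (h - c)\<^sup>2 * (\<Sum>i\<in>UNIV. \<Sum>j\<in>UNIV. (e $ i)\<^sup>2 * (e $ j)\<^sup>2)
      + c\<^sup>2 * (\<Sum>i\<in>UNIV. \<Sum>j\<in>UNIV. ?d i j)
      - 2 * (h - c) * (\<Sum>i\<in>UNIV. \<Sum>j\<in>UNIV. e $ i * (B $ i $ j * e $ j))
      - 2 * c * (\<Sum>i\<in>UNIV. \<Sum>j\<in>UNIV. ?d i j * B $ i $ i)
      + 2 * (h - c) * c * (\<Sum>i\<in>UNIV. \<Sum>j\<in>UNIV. ?d i j * (e $ i)\<^sup>2)"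
    by (simp only: sum.distrib sum_subtractf sum_distrib_left)
  also have "(\<Sum>i\<in>UNIV. \<Sum>j\<in>UNIV. (e $ i)\<^sup>2 * (e $ j)\<^sup>2) = 1"
    by (simp add: sum_product[symmetric] ee)
  also have "(\<Sum>i\<in>UNIV. \<Sum>j\<in>UNIV. ?d i j) = n" by (simp add: n_def)
  also have "(\<Sum>i\<in>UNIV. \<Sum>j\<in>UNIV. e $ i * (B $ i $ j * e $ j)) = h"
    by (simp add: h_def inner_vec_def matrix_vector_mult_def sum_distrib_left)
  also have "(\<Sum>i\<in>UNIV. \<Sum>j\<in>UNIV. ?d i j * B $ i $ i) = T"
    by (simp add: T_def if_distrib[of "\<lambda>x. x * _"] cong: if_cong)
  also have "(\<Sum>i\<in>UNIV. \<Sum>j\<in>UNIV. ?d i j * (e $ i)\<^sup>2) = 1"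
    by (simp add: ee if_distrib[of "\<lambda>x. x * _"] cong: if_cong)
  finally have "0 \<le> (\<Sum>i\<in>UNIV. \<Sum>j\<in>UNIV. (B $ i $ j)\<^sup>2) + (h - c)\<^sup>2 * 1 + c\<^sup>2 * n - 2 * (h - c) * h
       - 2 * c * T + 2 * (h - c) * c * 1" .
  moreover have "c\<^sup>2 * (n - 1) \<le> k * (T - h)\<^sup>2"
  proof -
    have "k * (T - h)\<^sup>2 * (k * (n - 1)) \<le> k * (T - h)\<^sup>2 * 1"
      using k by (intro mult_left_mono) (auto simp: n_def)
    then show ?thesis by (simp add: c_def power2_eq_square mult_ac)
  qed
  moreover have "c * (T - h) = k * (T - h)\<^sup>2" by (simp add: c_def power2_eq_square)
  ultimately have "h\<^sup>2 + k * (T - h)\<^sup>2 \<le> (\<Sum>i\<in>UNIV. \<Sum>j\<in>UNIV. (B $ i $ j)\<^sup>2)"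
    by (simp add: power2_eq_square algebra_simps)
  moreover have "g \<bullet> (B *v g) = h * (g \<bullet> g)"
  proof -
    have "g \<bullet> (B *v g) = (norm g *\<^sub>R e) \<bullet> (B *v (norm g *\<^sub>R e))" using e(2) by metis
    also have "\<dots> = (norm g)\<^sup>2 * h"
      by (simp add: h_def matrix_vector_mult_scaleR power2_eq_square)
    finally show ?thesis by (simp add: power2_norm_eq_inner)
  qed
  ultimately show ?thesis unfolding T_def by blast
qed

lemma norm_matrix_vector_le_hilbert_schmidt:
  fixes B :: "real ^ 'n::finite ^ 'n" and g :: "real ^ 'n"
  shows "norm (B *v g) \<le> sqrt (\<Sum>i\<in>UNIV. \<Sum>j\<in>UNIV. (B $ i $ j)\<^sup>2) * norm g"
proof -
  have "(norm (B *v g))\<^sup>2 = (\<Sum>i\<in>UNIV. (B $ i \<bullet> g)\<^sup>2)"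
    unfolding power2_norm_eq_inner inner_vec_def[of "B *v g"] matrix_vector_mul_component
    by (simp add: power2_eq_square)
  also have "\<dots> \<le> (\<Sum>i\<in>UNIV. (norm (B $ i))\<^sup>2 * (norm g)\<^sup>2)"
    by (intro sum_mono) (metis Cauchy_Schwarz_ineq power2_norm_eq_inner)
  also have "\<dots> = (\<Sum>i\<in>UNIV. \<Sum>j\<in>UNIV. (B $ i $ j)\<^sup>2) * (norm g)\<^sup>2"
  proof -
    have "(norm (B $ i))\<^sup>2 = (\<Sum>j\<in>UNIV. (B $ i $ j)\<^sup>2)" for i
      unfolding power2_norm_eq_inner inner_vec_def by (simp add: power2_eq_square)
    then show ?thesis by (simp add: sum_distrib_right[symmetric])
  qed
  finally have "norm (B *v g) \<le> sqrt ((\<Sum>i\<in>UNIV. \<Sum>j\<in>UNIV. (B $ i $ j)\<^sup>2) * (norm g)\<^sup>2)"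
    by (rule real_le_rsqrt)
  then show ?thesis by (simp add: real_sqrt_mult)
qed

section \<open>The weighted integral identity\<close>

text \<open>
At the origin this holds because \<open>|y|^q = o(|y|)\<close> for \<open>q > 1\<close>; the formula then has the value 0,
in accordance with \<open>0 powr b = 0\<close>.
\<close>

lemma has_derivative_norm_powr:
  fixes y :: "'a::euclidean_space"
  assumes q: "q > 1"
  shows "((\<lambda>y. norm y powr q) has_derivative (\<lambda>u. (q * norm y powr (q - 2)) *\<^sub>R y \<bullet> u)) (at y)"
proof (cases "y = 0")
  case False
  have n: "(norm has_derivative (\<lambda>u. sgn y \<bullet> u)) (at y)" using False
    using has_derivative_norm[OF False] by (simp add: inner_commute)
  have "((\<lambda>t. t powr q) has_derivative (\<lambda>s. q * norm y powr (q - 1) * s)) (at (norm y))"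
    using has_real_derivative_powr[of "norm y" q] False by (simp add: has_field_derivative_def)
  from has_derivative_compose[OF n this]
  have "((\<lambda>y. norm y powr q) has_derivative (\<lambda>u. q * norm y powr (q - 1) * (sgn y \<bullet> u))) (at y)" .
  moreover have "q * norm y powr (q - 1) * (sgn y \<bullet> u) = (q * norm y powr (q - 2)) *\<^sub>R y \<bullet> u" for u
    using False by (simp add: sgn_div_norm powr_diff power2_eq_square powr_numeral divide_inverse mult_ac)
  ultimately show ?thesis by simp
next
  case True
  have "((\<lambda>h. norm (norm h powr q) / norm h) \<longlongrightarrow> 0) (at (0::'a))"
  proof (rule Lim_transform_eventually)
    have "((\<lambda>h::'a. norm h powr (q - 1)) \<longlongrightarrow> norm (0::'a) powr (q - 1)) (at 0)"
      using q by (intro tendsto_powr' tendsto_intros) (auto intro!: always_eventually)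
    then show "((\<lambda>h::'a. norm h powr (q - 1)) \<longlongrightarrow> 0) (at 0)" by simp
    show "\<forall>\<^sub>F h::'a in at 0. norm h powr (q - 1) = norm (norm h powr q) / norm h"
      unfolding eventually_at by (intro exI[of _ 1]) (auto simp: powr_diff)
  qed
  then show ?thesis using True by (simp add: has_derivative_at)
qed

lemma continuous_norm_powr_scaleR:
  fixes g :: "'b::topological_space \<Rightarrow> 'a::euclidean_space"
  assumes q: "q > 1" and g: "continuous_on UNIV g"
  shows "continuous_on UNIV (\<lambda>x. norm (g x) powr (q - 2) *\<^sub>R g x)"
proof -
  have "isCont (\<lambda>y::'a. norm y powr (q - 2) *\<^sub>R y) y" for y
  proof (cases "y = 0")
    case False
    then show ?thesis by (auto intro!: continuous_intros)
  next
    case True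
    have "((\<lambda>y::'a. norm y powr (q - 2) *\<^sub>R y) \<longlongrightarrow> 0) (at 0)"
    proof (rule tendsto_norm_zero_cancel, rule Lim_transform_eventually)
      have "((\<lambda>h::'a. norm h powr (q - 1)) \<longlongrightarrow> norm (0::'a) powr (q - 1)) (at 0)"
        using q by (intro tendsto_powr' tendsto_intros) (auto intro!: always_eventually)
      then show "((\<lambda>h::'a. norm h powr (q - 1)) \<longlongrightarrow> 0) (at 0)" by simp
      show "\<forall>\<^sub>F h::'a in at 0. norm h powr (q - 1) = norm (norm h powr (q - 2) *\<^sub>R h)"
        unfolding eventually_at by (intro exI[of _ 1]) (auto simp: powr_diff power2_eq_square)
    qed
    then show ?thesis using True by (simp add: isCont_def)
  qed
  then have "continuous_on UNIV (\<lambda>y::'a. norm y powr (q - 2) *\<^sub>R y)"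
    by (simp add: continuous_at_imp_continuous_on)
  then show ?thesis by (rule continuous_on_compose2[OF _ g]) auto
qed

lemma has_derivative_powr_scalar:
  fixes v :: "'a::euclidean_space \<Rightarrow> real"
  assumes "(v has_derivative (\<lambda>u. g \<bullet> u)) (at x)" "v x > 0"
  shows "((\<lambda>x. v x powr b) has_derivative (\<lambda>u. ((b * v x powr (b - 1)) *\<^sub>R g) \<bullet> u)) (at x)"
proof -
  have "((\<lambda>t. t powr b) has_derivative (\<lambda>s. b * v x powr (b - 1) * s)) (at (v x))"
    using has_real_derivative_powr[of "v x" b] assms(2) by (simp add: has_field_derivative_def)
  from has_derivative_compose[OF assms(1) this] show ?thesis by simp
qed

lemma has_derivative_mult_inner:
  fixes f g :: "'a::euclidean_space \<Rightarrow> real"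
  assumes "(f has_derivative (\<lambda>u. F \<bullet> u)) (at x)" "(g has_derivative (\<lambda>u. G \<bullet> u)) (at x)"
  shows "((\<lambda>x. f x * g x) has_derivative (\<lambda>u. (g x *\<^sub>R F + f x *\<^sub>R G) \<bullet> u)) (at x)"
  using has_derivative_mult[OF assms] by (simp add: inner_add_left algebra_simps)

lemma continuous_hess_vec:
  assumes v: "C2_fun v" and w: "continuous_on UNIV w"
  shows "continuous_on UNIV (\<lambda>x. hess v x *v w x)"
  unfolding matrix_vector_mult_def
  by (intro continuous_on_vec_lambda continuous_intros C2_fun_continuous_hess[OF v] w)

text \<open>
The symmetry of the Hessian turns the derivative into a gradient.
\<close>

lemma has_derivative_grad_compose:
  fixes v :: "real ^ 'n::finite \<Rightarrow> real"
  assumes v: "C2_fun v" and f: "(f has_derivative (\<lambda>u. w \<bullet> u)) (at (grad v x))"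
  shows "((\<lambda>x. f (grad v x)) has_derivative (\<lambda>u. (hess v x *v w) \<bullet> u)) (at x)"
proof -
  have "((\<lambda>x. f (grad v x)) has_derivative (\<lambda>u. w \<bullet> (hess v x *v u))) (at x)"
    by (rule has_derivative_compose[OF has_derivative_grad_vec[OF v] f])
  moreover have "transpose (hess v x) = hess v x"
    by (simp add: vec_eq_iff transpose_def hess_symmetric[OF v])
  then have "w \<bullet> (hess v x *v u) = (hess v x *v w) \<bullet> u" for u
    by (metis dot_lmul_matrix transpose_matrix_vector)
  ultimately show ?thesis by simp
qed


lemma weighted_green:
  fixes v \<eta> \<omega> :: "real ^ 'n::finite \<Rightarrow> real"
  assumes v: "C2_fun v"
    and \<eta>: "\<And>x. (\<eta> has_derivative (\<lambda>u. E x \<bullet> u)) (at x)" "continuous_on UNIV E"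
    and supp: "\<And>x. norm x > R \<Longrightarrow> \<eta> x = 0"
    and \<omega>: "\<And>x. (\<omega> has_derivative (\<lambda>u. W x \<bullet> u)) (at x)" "continuous_on UNIV W"
  defines "S \<equiv> \<lambda>x. \<eta> x * (\<omega> x * laplacian v x + W x \<bullet> grad v x) + \<omega> x * (E x \<bullet> grad v x)"
  shows "integrable lborel S \<and> (\<integral>x. S x \<partial>lborel) = 0"
proof -
  have c: "continuous_on UNIV \<eta>" "continuous_on UNIV \<omega>"
    using \<eta>(1) \<omega>(1) by (meson continuous_at_imp_continuous_on has_derivative_continuous)+
  have d: "((\<lambda>x. \<eta> x * \<omega> x) has_derivative (\<lambda>u. (\<omega> x *\<^sub>R E x + \<eta> x *\<^sub>R W x) \<bullet> u)) (at x)" for x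
    by (rule has_derivative_mult_inner[OF \<eta>(1) \<omega>(1)])
  have cd: "continuous_on UNIV (\<lambda>x. \<omega> x *\<^sub>R E x + \<eta> x *\<^sub>R W x)"
    by (intro continuous_intros c \<eta>(2) \<omega>(2))
  have "S = (\<lambda>x. \<eta> x * \<omega> x * laplacian v x + (\<omega> x *\<^sub>R E x + \<eta> x *\<^sub>R W x) \<bullet> grad v x)"
    by (simp add: S_def inner_add_left algebra_simps)
  then show ?thesis
    using integral_green[OF v d cd, where R = R] supp by simp
qed

lemma weighted_bochner:
  fixes v \<eta> \<omega> :: "real ^ 'n::finite \<Rightarrow> real"
  assumes v: "C2_fun v"
    and \<eta>: "\<And>x. (\<eta> has_derivative (\<lambda>u. E x \<bullet> u)) (at x)" "continuous_on UNIV E"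
    and supp: "\<And>x. norm x > R \<Longrightarrow> \<eta> x = 0"
    and \<omega>: "\<And>x. (\<omega> has_derivative (\<lambda>u. W x \<bullet> u)) (at x)" "continuous_on UNIV W"
  defines "B \<equiv> \<lambda>x. hess v x *v grad v x - laplacian v x *\<^sub>R grad v x"
  defines "S \<equiv> \<lambda>x. \<eta> x * (\<omega> x * ((\<Sum>i\<in>UNIV. \<Sum>j\<in>UNIV. (hess v x $ i $ j)\<^sup>2) - (laplacian v x)\<^sup>2)
      + W x \<bullet> B x) + \<omega> x * (E x \<bullet> B x)"
  shows "integrable lborel S \<and> (\<integral>x. S x \<partial>lborel) = 0"
proof -
  have c: "continuous_on UNIV \<eta>" "continuous_on UNIV \<omega>"
    using \<eta>(1) \<omega>(1) by (meson continuous_at_imp_continuous_on has_derivative_continuous)+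
  have d: "((\<lambda>x. \<eta> x * \<omega> x) has_derivative (\<lambda>u. (\<omega> x *\<^sub>R E x + \<eta> x *\<^sub>R W x) \<bullet> u)) (at x)" for x
    by (rule has_derivative_mult_inner[OF \<eta>(1) \<omega>(1)])
  have cd: "continuous_on UNIV (\<lambda>x. \<omega> x *\<^sub>R E x + \<eta> x *\<^sub>R W x)"
    by (intro continuous_intros c \<eta>(2) \<omega>(2))
  have "S = (\<lambda>x. \<eta> x * \<omega> x * ((\<Sum>i\<in>UNIV. \<Sum>j\<in>UNIV. (hess v x $ i $ j)\<^sup>2) - (laplacian v x)\<^sup>2)
      + (\<omega> x *\<^sub>R E x + \<eta> x *\<^sub>R W x) \<bullet> B x)"
    by (simp add: S_def inner_add_left algebra_simps)
  then show ?thesis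
    using integral_bochner[OF v d cd, where R = R] supp by (simp add: B_def)
qed

text \<open>
The sum of the weak Bochner formula for the test function \<open>\<eta> v^a\<close> and of \<open>c3\<close>, \<open>c4\<close>, \<open>c5\<close> times
Green's formula for \<open>\<eta> v^(a-1) |grad v|^2\<close>, \<open>\<eta> v^(a+p)\<close>, \<open>M \<eta> v^a |grad v|^q\<close>, with the Laplacian
replaced by \<open>- F\<close>.
\<close>

lemma weighted_identity:
  fixes v \<eta> :: "real ^ 'n::finite \<Rightarrow> real" and hh :: "real ^ 'n \<Rightarrow> real" and a c3 c4 c5 p q M R :: real
  assumes v: "C2_fun v" and pos: "\<And>x. v x > 0" and q: "q > 1"
    and pde: "\<And>x. laplacian v x + v x powr p + M * norm (grad v x) powr q = 0"
    and \<eta>: "\<And>x. (\<eta> has_derivative (\<lambda>u. E x \<bullet> u)) (at x)" "continuous_on UNIV E"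
    and supp: "\<And>x. norm x > R \<Longrightarrow> \<eta> x = 0"
    and hh: "\<And>x. grad v x \<bullet> (hess v x *v grad v x) = hh x * (grad v x \<bullet> grad v x)"
  defines "U \<equiv> \<lambda>x. \<Sum>i\<in>UNIV. \<Sum>j\<in>UNIV. (hess v x $ i $ j)\<^sup>2"
    and "X \<equiv> \<lambda>x. (norm (grad v x))\<^sup>2 / v x" and "Y \<equiv> \<lambda>x. v x powr p"
    and "Z \<equiv> \<lambda>x. M * norm (grad v x) powr q"
  defines "F \<equiv> \<lambda>x. Y x + Z x"
  defines "S \<equiv> \<lambda>x. v x powr a * (\<eta> x * (U x - (F x)\<^sup>2 + a * (hh x + F x) * X x
        + c3 * (- X x * F x + (a - 1) * (X x)\<^sup>2 + 2 * X x * hh x)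
        + c4 * (- Y x * F x + (a + p) * X x * Y x)
        + c5 * (- Z x * F x + a * X x * Z x + q * Z x * hh x))
      + E x \<bullet> (hess v x *v grad v x + (F x + c3 * X x + c4 * Y x + c5 * Z x) *\<^sub>R grad v x))"
  shows "integrable lborel S \<and> (\<integral>x. S x \<partial>lborel) = 0"
proof -
  let ?g = "grad v" and ?H = "hess v"
  have vc: "continuous_on UNIV v" by (rule C2_fun_continuous[OF v])
  have gc: "continuous_on UNIV ?g" by (rule C2_fun_continuous_grad[OF v])
  have v0: "v x \<noteq> 0" for x using pos[of x] by simp
  have pw: "((\<lambda>x. v x powr b) has_derivative (\<lambda>u. ((b * v x powr (b - 1)) *\<^sub>R ?g x) \<bullet> u)) (at x)" for b x
    by (rule has_derivative_powr_scalar[OF C2_fun_D1[OF v] pos])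
  have pwc: "continuous_on UNIV (\<lambda>x. v x powr b)" for b
    using v0 by (intro continuous_intros vc) auto
  have sq: "((\<lambda>x. ?g x \<bullet> ?g x) has_derivative (\<lambda>u. (?H x *v (2 *\<^sub>R ?g x)) \<bullet> u)) (at x)" for x
    by (rule has_derivative_grad_compose[OF v, where f = "\<lambda>y. y \<bullet> y"])
      (auto intro!: derivative_eq_intros simp: inner_commute)
  have gq: "((\<lambda>x. norm (?g x) powr q) has_derivative
      (\<lambda>u. (?H x *v ((q * norm (?g x) powr (q - 2)) *\<^sub>R ?g x)) \<bullet> u)) (at x)" for x
    by (rule has_derivative_grad_compose[OF v, where f = "\<lambda>y. norm y powr q"])
      (rule has_derivative_norm_powr[OF q])
  have gqc: "continuous_on UNIV (\<lambda>x. ?H x *v ((q * norm (?g x) powr (q - 2)) *\<^sub>R ?g x))"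
    using continuous_on_scaleR[OF continuous_on_const[of UNIV q] continuous_norm_powr_scaleR[OF q gc]]
    by (intro continuous_hess_vec v) simp
  have nqc: "continuous_on UNIV (\<lambda>x. norm (?g x) powr q)"
    using q by (intro continuous_on_powr' continuous_intros gc) auto
  define S1 where "S1 = (\<lambda>x. \<eta> x * (v x powr a * (U x - (laplacian v x)\<^sup>2)
      + ((a * v x powr (a - 1)) *\<^sub>R ?g x) \<bullet> (?H x *v ?g x - laplacian v x *\<^sub>R ?g x))
      + v x powr a * (E x \<bullet> (?H x *v ?g x - laplacian v x *\<^sub>R ?g x)))"
  \<comment> \<open>The gradients of the weights \<open>v^(a-1) |grad v|^2\<close> and, below, \<open>v^a |grad v|^q\<close>.\<close>
  define W3 where "W3 x = (?g x \<bullet> ?g x) *\<^sub>R (((a - 1) * v x powr (a - 1 - 1)) *\<^sub>R ?g x)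
      + v x powr (a - 1) *\<^sub>R (?H x *v (2 *\<^sub>R ?g x))" for x
  define S3 where "S3 = (\<lambda>x. \<eta> x * (v x powr (a - 1) * (?g x \<bullet> ?g x) * laplacian v x + W3 x \<bullet> ?g x)
      + v x powr (a - 1) * (?g x \<bullet> ?g x) * (E x \<bullet> ?g x))"
  define S4 where "S4 = (\<lambda>x. \<eta> x * (v x powr (a + p) * laplacian v x
      + (((a + p) * v x powr (a + p - 1)) *\<^sub>R ?g x) \<bullet> ?g x) + v x powr (a + p) * (E x \<bullet> ?g x))"
  define W5 where "W5 x = norm (?g x) powr q *\<^sub>R ((a * v x powr (a - 1)) *\<^sub>R ?g x)
      + v x powr a *\<^sub>R (?H x *v ((q * norm (?g x) powr (q - 2)) *\<^sub>R ?g x))" for x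
  define S5 where "S5 = (\<lambda>x. \<eta> x * (v x powr a * norm (?g x) powr q * laplacian v x + W5 x \<bullet> ?g x)
      + v x powr a * norm (?g x) powr q * (E x \<bullet> ?g x))"
  have i1: "integrable lborel S1 \<and> (\<integral>x. S1 x \<partial>lborel) = 0"
    unfolding S1_def U_def
    by (rule weighted_bochner[OF v \<eta> supp pw]) (auto intro!: continuous_intros pwc gc)
  have i3: "integrable lborel S3 \<and> (\<integral>x. S3 x \<partial>lborel) = 0"
    unfolding S3_def
  proof (rule weighted_green[OF v \<eta> supp])
    show "((\<lambda>x. v x powr (a - 1) * (?g x \<bullet> ?g x)) has_derivative (\<lambda>u. W3 x \<bullet> u)) (at x)" for x
      unfolding W3_def by (rule has_derivative_mult_inner[OF pw sq])
    show "continuous_on UNIV W3" unfolding W3_def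
      by (intro continuous_intros pwc gc continuous_hess_vec v)
  qed
  have i4: "integrable lborel S4 \<and> (\<integral>x. S4 x \<partial>lborel) = 0"
    unfolding S4_def
    by (rule weighted_green[OF v \<eta> supp pw]) (auto intro!: continuous_intros pwc gc)
  have i5: "integrable lborel S5 \<and> (\<integral>x. S5 x \<partial>lborel) = 0"
    unfolding S5_def
  proof (rule weighted_green[OF v \<eta> supp])
    show "((\<lambda>x. v x powr a * norm (?g x) powr q) has_derivative (\<lambda>u. W5 x \<bullet> u)) (at x)" for x
      unfolding W5_def by (rule has_derivative_mult_inner[OF pw gq])
    show "continuous_on UNIV W5" unfolding W5_def
      by (intro continuous_intros pwc gc gqc nqc)
  qed
  have "S x = S1 x + c3 * S3 x + c4 * S4 x + c5 * (M * S5 x)" for x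
  proof -
    define V where "V = v x powr a"
    define n where "n = norm (?g x) powr q"
    define G where "G = ?g x \<bullet> ?g x"
    define d where "d = (?H x *v ?g x) \<bullet> ?g x"
    define k where "k = norm (?g x) powr (q - 2)"
    define e where "e = E x \<bullet> ?g x"
    define e' where "e' = E x \<bullet> (?H x *v ?g x)"
    define w where "w = v x"
    have w: "w > 0" using pos by (simp add: w_def)
    have P: "v x powr (a - 1) = V / w" "v x powr (a - 2) = V / w\<^sup>2" "v x powr (a + p) = V * Y x"
      "v x powr (a + p - 1) = V * Y x / w"
      using pos[of x] by (simp_all add: V_def w_def Y_def powr_diff powr_add powr_numeral)
    have lap: "laplacian v x = - F x" using pde[of x] by (simp add: F_def Y_def Z_def)
    have X: "X x = G / w" by (simp add: X_def G_def w_def power2_norm_eq_inner)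
    have d: "d = hh x * G" using hh[of x] by (simp add: d_def G_def inner_commute)
    have kG: "k * G = n"
    proof (cases "?g x = 0")
      case False
      then have "k * G = norm (?g x) powr (q - 2) * norm (?g x) powr 2"
        by (simp add: k_def G_def power2_norm_eq_inner[symmetric] powr_numeral)
      also have "\<dots> = n" unfolding n_def powr_add[symmetric] by simp
      finally show ?thesis .
    qed (simp add: G_def n_def)
    have Hg: "?H x *v (r *\<^sub>R ?g x) = r *\<^sub>R (?H x *v ?g x)" for r
      by (simp add: matrix_vector_mult_scaleR)
    have gd: "?g x \<bullet> (?H x *v ?g x) = d" by (simp add: d_def inner_commute)
    have s1: "S1 x = \<eta> x * (V * (U x - (F x)\<^sup>2) + (a * (V / w) * d + F x * (a * (V / w) * G))) + V * (e' + F x * e)"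
      by (simp add: S1_def lap P V_def[symmetric] inner_diff_right gd G_def[symmetric] e_def e'_def inner_add_right)
    have s3: "S3 x = \<eta> x * (V / w * G * (- F x) + G * ((a - 1) * (V / w\<^sup>2) * G) + V / w * (2 * d)) + V / w * G * e"
      by (simp add: S3_def W3_def lap P Hg inner_add_left G_def[symmetric] d_def[symmetric] e_def)
    have s4: "S4 x = \<eta> x * (V * Y x * (- F x) + (a + p) * (V * Y x / w) * G) + V * Y x * e"
      by (simp add: S4_def lap P G_def[symmetric] e_def)
    have s5: "S5 x = \<eta> x * (V * n * (- F x) + n * (a * (V / w) * G) + V * (q * (k * d))) + V * n * e"
      by (simp add: S5_def W5_def lap P Hg inner_add_left V_def[symmetric] n_def[symmetric] k_def[symmetric]
          G_def[symmetric] d_def[symmetric] e_def)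
    have Z: "Z x = M * n" by (simp add: Z_def n_def)
    have s: "S x = V * (\<eta> x * (U x - (F x)\<^sup>2 + a * (hh x + F x) * X x
        + c3 * (- X x * F x + (a - 1) * (X x)\<^sup>2 + 2 * X x * hh x)
        + c4 * (- Y x * F x + (a + p) * X x * Y x)
        + c5 * (- Z x * F x + a * X x * Z x + q * Z x * hh x))
      + e' + (F x + c3 * X x + c4 * Y x + c5 * Z x) * e)"
      by (simp add: S_def V_def e_def e'_def inner_add_right)
    \<comment> \<open>Only inverse powers of \<open>v\<close> remain, so the identity is polynomial in \<open>r = 1 / v\<close>.\<close>
    define r where "r = inverse w"
    show ?thesis
      unfolding s s1 s3 s4 s5 d X Z power2_eq_square divide_inverse inverse_mult_distrib r_def[symmetric]
      by (simp add: algebra_simps kG[symmetric])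
  qed
  then have eq: "S = (\<lambda>x. S1 x + c3 * S3 x + c4 * S4 x + c5 * (M * S5 x))" by (rule ext)
  show ?thesis unfolding eq using i1 i3 i4 i5 by simp
qed

section \<open>Absorption of the cutoff terms\<close>

text \<open>
Young's inequality, twice. In the application \<open>t = |grad v|\<close>, \<open>u\<close> is the square norm of the
Hessian, \<open>s = X + Y\<close>, and \<open>w\<close> is the reciprocal of the radius times the cutoff.
\<close>

lemma gradient_cutoff_absorbed:
  fixes \<epsilon> C :: real
  assumes e: "\<epsilon> > 0" and C: "C \<ge> 0"
  obtains D where "D \<ge> 0"
    "\<And>u s t v w. 0 \<le> u \<Longrightarrow> 0 \<le> s \<Longrightarrow> 0 \<le> t \<Longrightarrow> t\<^sup>2 \<le> s * v \<Longrightarrow> 0 \<le> w \<Longrightarrow>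
       C * (sqrt u + s) * t * w \<le> \<epsilon> / 2 * (u + s\<^sup>2) + D * (v\<^sup>2 * w ^ 4)"
proof
  define K where "K = 3 * C\<^sup>2 / (2 * \<epsilon>)"
  have K: "K \<ge> 0" using e by (simp add: K_def)
  show "K\<^sup>2 / \<epsilon> \<ge> 0" using e by simp
  fix u s t v w :: real
  assume *: "0 \<le> u" "0 \<le> s" "0 \<le> t" "t\<^sup>2 \<le> s * v" "0 \<le> w"
  have young: "x * y \<le> \<delta> * x\<^sup>2 + y\<^sup>2 / (4 * \<delta>)" if "\<delta> > 0" for x y \<delta> :: real
  proof -
    have "0 \<le> (2 * \<delta> * x - y)\<^sup>2 / (4 * \<delta>)" using that by simp
    also have "\<dots> = \<delta> * x\<^sup>2 + y\<^sup>2 / (4 * \<delta>) - x * y"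
      using that by (simp add: power2_diff diff_divide_distrib add_divide_distrib power_mult_distrib)
        (simp add: power2_eq_square)
    finally show ?thesis by simp
  qed
  define y where "y = C * t * w"
  have "C * (sqrt u + s) * t * w = sqrt u * y + s * y" by (simp add: y_def algebra_simps)
  also have "\<dots> \<le> (\<epsilon> / 2 * u + y\<^sup>2 / (2 * \<epsilon>)) + (\<epsilon> / 4 * s\<^sup>2 + y\<^sup>2 / \<epsilon>)"
    using young[of "\<epsilon> / 2" "sqrt u" y] young[of "\<epsilon> / 4" s y] e * by (intro add_mono) auto
  also have "\<dots> = \<epsilon> / 2 * u + \<epsilon> / 4 * s\<^sup>2 + K * (t\<^sup>2 * w\<^sup>2)"
    using e by (simp add: K_def y_def power_mult_distrib field_simps)
  also have "K * (t\<^sup>2 * w\<^sup>2) \<le> K * ((s * v) * w\<^sup>2)"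
    using K * by (intro mult_left_mono mult_right_mono) auto
  also have "K * ((s * v) * w\<^sup>2) = s * (K * (v * w\<^sup>2))" by (simp only: mult_ac)
  also have "s * (K * (v * w\<^sup>2)) \<le> \<epsilon> / 4 * s\<^sup>2 + (K * (v * w\<^sup>2))\<^sup>2 / \<epsilon>"
    using young[of "\<epsilon> / 4" s "K * (v * w\<^sup>2)"] e by simp
  also have "(K * (v * w\<^sup>2))\<^sup>2 / \<epsilon> = K\<^sup>2 / \<epsilon> * (v\<^sup>2 * w ^ 4)"
    by (simp add: power2_eq_square power4_eq_xxxx)
  finally show "C * (sqrt u + s) * t * w \<le> \<epsilon> / 2 * (u + s\<^sup>2) + K\<^sup>2 / \<epsilon> * (v\<^sup>2 * w ^ 4)"
    by (simp add: distrib_left)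
qed

text \<open>
If \<open>D w^4 \<le> \<epsilon> v^(2p-2)\<close>, the first term on the right suffices. Otherwise \<open>v\<close> is bounded by a power
of \<open>w\<close>, and as \<open>a + 2 \<ge> 0\<close> this bounds the left side by a power of \<open>w\<close>.
\<close>

lemma lower_order_absorbed:
  fixes \<epsilon> D a p :: real
  assumes e: "\<epsilon> > 0" and D: "D \<ge> 0" and a: "a + 2 \<ge> 0" and p: "p > 1"
  obtains C where "C \<ge> 0"
    "\<And>v w. v > 0 \<Longrightarrow> w > 0 \<Longrightarrow>
       v powr a * (D * (v\<^sup>2 * w ^ 4)) \<le> \<epsilon> * v powr (a + 2 * p) + C * w powr (2 * (a + 2 * p) / (p - 1))"
proof
  define r where "r = (a + 2) / (2 * p - 2)"
  have r: "r \<ge> 0" using a p by (simp add: r_def)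
  show "D * (D / \<epsilon>) powr r \<ge> 0" using D by simp
  fix v w :: real assume v: "v > 0" and w: "w > 0"
  show "v powr a * (D * (v\<^sup>2 * w ^ 4)) \<le> \<epsilon> * v powr (a + 2 * p)
      + D * (D / \<epsilon>) powr r * w powr (2 * (a + 2 * p) / (p - 1))"
  proof (cases "D * w ^ 4 \<le> \<epsilon> * v powr (2 * p - 2)")
    case True
    have "v powr a * (D * (v\<^sup>2 * w ^ 4)) = v powr (a + 2) * (D * w ^ 4)"
      using v by (simp add: powr_add)
    also have "\<dots> \<le> v powr (a + 2) * (\<epsilon> * v powr (2 * p - 2))"
      using True by (intro mult_left_mono) auto
    also have "\<dots> = \<epsilon> * (v powr (a + 2) * v powr (2 * p - 2))" by simp
    also have "\<dots> = \<epsilon> * v powr (a + 2 * p)" unfolding powr_add[symmetric] by simp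
    finally show ?thesis using D by (intro add_increasing2) auto
  next
    case False
    then have "v powr (2 * p - 2) \<le> D / \<epsilon> * w ^ 4" using e by (simp add: field_simps)
    then have "(v powr (2 * p - 2)) powr r \<le> (D / \<epsilon> * w ^ 4) powr r"
      using r by (intro powr_mono2) auto
    moreover have "(v powr (2 * p - 2)) powr r = v powr (a + 2)"
      using p by (simp add: powr_powr r_def)
    moreover have "(D / \<epsilon> * w ^ 4) powr r = (D / \<epsilon>) powr r * w powr (4 * r)"
    proof -
      have "(w ^ 4) powr r = (w powr 4) powr r" using w by (simp add: powr_numeral)
      also have "\<dots> = w powr (4 * r)" by (rule powr_powr)
      finally show ?thesis using D e w powr_mult[of "D / \<epsilon>" "w ^ 4" r] by simp
    qed
    ultimately have le: "v powr (a + 2) \<le> (D / \<epsilon>) powr r * w powr (4 * r)" by simp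
    have "v powr a * (D * (v\<^sup>2 * w ^ 4)) = D * w ^ 4 * v powr (a + 2)"
      using v by (simp add: powr_add)
    also have "\<dots> \<le> D * w ^ 4 * ((D / \<epsilon>) powr r * w powr (4 * r))"
      using le D w by (intro mult_left_mono) auto
    also have "\<dots> = D * (D / \<epsilon>) powr r * (w powr 4 * w powr (4 * r))"
      using w by (simp add: powr_numeral)
    also have "w powr 4 * w powr (4 * r) = w powr (2 * (a + 2 * p) / (p - 1))"
    proof -
      have "4 + 4 * r = 2 * (a + 2 * p) / (p - 1)" using p by (simp add: r_def field_simps)
      then show ?thesis by (simp add: powr_add[symmetric])
    qed
    finally show ?thesis using e by (intro add_increasing) auto
  qed
qed

section \<open>Nonexistence of positive solutions\<close>

text \<open>
The assumption \<open>crit\<close> makes \<open>(p-1)/(p+3)\<close> an admissible constant in \<open>hilbert_schmidt_lower_bound\<close> and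
gives \<open>\<sigma> > n\<close>; the bound \<open>p \<le> 5\<close> ensures \<open>a + 2 \<ge> 0\<close>.
\<close>

lemma no_positive_solution:
  fixes v :: "real ^ 'n::finite \<Rightarrow> real" and p M :: real
  assumes v: "C2_fun v" and pos: "\<And>x. v x > 0" and p: "p > 1" "p \<le> 5" and M: "M > 0"
    and crit: "(real CARD('n) - 2) * p \<le> real CARD('n) + 2"
    and pde: "\<And>x. laplacian v x + v x powr p + M * norm (grad v x) powr (2 * p / (p + 1)) = 0"
  shows False
proof -
  define n where "n = real CARD('n)"
  define q where "q = 2 * p / (p + 1)"
  have q: "q > 1" using p by (simp add: q_def field_simps)
  obtain a c3 c4 c5 \<epsilon> where a: "a > - (p - 1) / 2" and e: "\<epsilon> > 0" and
    coer: "\<And>X Y h u F Z. X \<ge> 0 \<Longrightarrow> Y \<ge> 0 \<Longrightarrow> Z = M * (X powr (p / (p + 1)) * Y powr (1 / (p + 1))) \<Longrightarrow>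
       F = Y + Z \<Longrightarrow> u \<ge> h\<^sup>2 + (p - 1) / (p + 3) * (F + h)\<^sup>2 \<Longrightarrow>
       \<epsilon> * (u + (X + Y)\<^sup>2) \<le> u - F\<^sup>2 + a * (h + F) * X + c3 * (- X * F + (a - 1) * X\<^sup>2 + 2 * X * h)
         + c4 * (- Y * F + (a + p) * X * Y) + c5 * (- Z * F + a * X * Z + q * Z * h)"
    by (rule coercive_coefficients[OF p(1) M, folded q_def]) blast
  \<comment> \<open>The error of the cutoff scales like \<open>R powr (n - \<sigma>)\<close>.\<close>
  define \<sigma> where "\<sigma> = 2 * (a + 2 * p) / (p - 1)"
  have sig: "\<sigma> > n"
  proof -
    have "n * (p - 1) \<le> 3 * p + 1" using crit p by (simp add: n_def algebra_simps)
    also have "\<dots> < 2 * (a + 2 * p)" using a by (simp add: field_simps)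
    finally show ?thesis using p by (simp add: \<sigma>_def pos_less_divide_eq)
  qed
  \<comment> \<open>The cutoff is \<open>bump 0 R ^ k\<close>: the exponent 2 makes it continuously differentiable, and \<open>\<sigma>\<close> makes
    \<open>bump ^ k * w powr \<sigma>\<close> bounded by \<open>R powr - \<sigma>\<close> when \<open>w = 1 / (R * bump)\<close>.\<close>
  define k where "k = max 2 (nat \<lceil>\<sigma>\<rceil>)"
  have k: "k \<ge> 2" "real k \<ge> \<sigma>" by (auto simp: k_def) linarith
  define g where "g x = grad v x" for x
  define U where "U x = (\<Sum>i\<in>UNIV. \<Sum>j\<in>UNIV. (hess v x $ i $ j)\<^sup>2)" for x
  define X where "X x = (norm (g x))\<^sup>2 / v x" for x
  define Y where "Y x = v x powr p" for x
  define Z where "Z x = M * norm (g x) powr q" for x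
  define F where "F x = Y x + Z x" for x
  have lap: "laplacian v x = - F x" for x
    using pde[of x] by (simp add: F_def Y_def Z_def q_def g_def)
  have XY: "X x \<ge> 0" "Y x \<ge> 0" "U x \<ge> 0" for x
    using pos[of x] by (auto simp: X_def Y_def U_def intro!: sum_nonneg)
  have Zf: "Z x = M * (X x powr (p / (p + 1)) * Y x powr (1 / (p + 1)))" for x
  proof -
    have "X x powr (p / (p + 1)) = norm (g x) powr (2 * (p / (p + 1))) / v x powr (p / (p + 1))"
      using pos[of x] powr_powr[of "norm (g x)" 2 "p / (p + 1)"]
      by (simp add: X_def powr_divide)
    then show ?thesis
      using pos[of x] by (simp add: Z_def Y_def powr_powr q_def)
  qed
  have "\<exists>h. g x \<bullet> (hess v x *v g x) = h * (g x \<bullet> g x) \<and> h\<^sup>2 + (p - 1) / (p + 3) * (F x + h)\<^sup>2 \<le> U x" for x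
  proof -
    have "(p - 1) * (n - 1) \<le> p + 3" using crit by (simp add: n_def algebra_simps)
    then have "(p - 1) / (p + 3) * (real CARD('n) - 1) \<le> 1"
      using p by (simp add: n_def divide_le_eq)
    moreover have "(p - 1) / (p + 3) \<ge> 0" using p by simp
    ultimately obtain h where h: "g x \<bullet> (hess v x *v g x) = h * (g x \<bullet> g x)"
      "h\<^sup>2 + (p - 1) / (p + 3) * ((\<Sum>i\<in>UNIV. hess v x $ i $ i) - h)\<^sup>2 \<le> U x"
      using hilbert_schmidt_lower_bound[of "(p - 1) / (p + 3)" "g x" "hess v x"] unfolding U_def by blast
    have "(\<Sum>i\<in>UNIV. hess v x $ i $ i) - h = - (F x + h)"
      using lap[of x] by (simp add: laplacian_eq_trace_hess)
    with h(2) have "h\<^sup>2 + (p - 1) / (p + 3) * (F x + h)\<^sup>2 \<le> U x" by (simp only: power2_minus)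
    with h(1) show ?thesis by blast
  qed
  then obtain hh where hh: "\<And>x. g x \<bullet> (hess v x *v g x) = hh x * (g x \<bullet> g x)"
    "\<And>x. (hh x)\<^sup>2 + (p - 1) / (p + 3) * (F x + hh x)\<^sup>2 \<le> U x" by metis
  define Q where "Q x = U x - (F x)\<^sup>2 + a * (hh x + F x) * X x
        + c3 * (- X x * F x + (a - 1) * (X x)\<^sup>2 + 2 * X x * hh x)
        + c4 * (- Y x * F x + (a + p) * X x * Y x)
        + c5 * (- Z x * F x + a * X x * Z x + q * Z x * hh x)" for x
  have Q: "Q x \<ge> \<epsilon> * (U x + (X x + Y x)\<^sup>2)" for x
    unfolding Q_def by (rule coer[OF XY(1,2) Zf F_def hh(2)])
  define W where "W x = hess v x *v g x + (F x + c3 * X x + c4 * Y x + c5 * Z x) *\<^sub>R g x" for x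
  define C where "C = 1 + (1 + M + \<bar>c3\<bar> + \<bar>c4\<bar> + \<bar>c5\<bar> * M)"
  have C: "C \<ge> 1" using M by (simp add: C_def)
  have Wb: "norm (W x) \<le> C * (sqrt (U x) + (X x + Y x)) * norm (g x)" for x
  proof -
    define s where "s = X x + Y x"
    have s: "0 \<le> s" "X x \<le> s" "Y x \<le> s" using XY by (auto simp: s_def)
    have "X x powr (p / (p + 1)) * Y x powr (1 / (p + 1)) \<le> s powr (p / (p + 1)) * s powr (1 / (p + 1))"
      using XY s p by (intro mult_mono powr_mono2) auto
    also have "\<dots> = s"
    proof -
      have "p / (p + 1) + 1 / (p + 1) = 1" using p by (simp add: field_simps)
      then show ?thesis using s by (simp add: powr_add[symmetric])
    qed
    finally have Zs: "Z x \<le> M * s" "0 \<le> Z x" using M by (simp_all add: Zf)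
    have "\<bar>F x\<bar> \<le> s + M * s" using Zs s XY[of x] by (simp add: F_def)
    moreover have "\<bar>c3 * X x\<bar> \<le> \<bar>c3\<bar> * s" "\<bar>c4 * Y x\<bar> \<le> \<bar>c4\<bar> * s" "\<bar>c5 * Z x\<bar> \<le> \<bar>c5\<bar> * (M * s)"
      unfolding abs_mult using Zs s XY[of x] by (auto intro!: mult_left_mono)
    ultimately have "\<bar>F x + c3 * X x + c4 * Y x + c5 * Z x\<bar>
        \<le> s + M * s + \<bar>c3\<bar> * s + \<bar>c4\<bar> * s + \<bar>c5\<bar> * (M * s)" by linarith
    also have "\<dots> = (C - 1) * s" by (simp add: C_def algebra_simps)
    finally have coef: "\<bar>F x + c3 * X x + c4 * Y x + c5 * Z x\<bar> \<le> (C - 1) * s" .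
    have "norm (W x) \<le> sqrt (U x) * norm (g x) + \<bar>F x + c3 * X x + c4 * Y x + c5 * Z x\<bar> * norm (g x)"
      unfolding W_def U_def
      by (intro order_trans[OF norm_triangle_ineq] add_mono norm_matrix_vector_le_hilbert_schmidt) simp
    also have "\<dots> \<le> (C * sqrt (U x)) * norm (g x) + (C * s) * norm (g x)"
    proof (intro add_mono mult_right_mono)
      show "sqrt (U x) \<le> C * sqrt (U x)" using C XY(3)[of x] by (simp add: mult_le_cancel_right1)
      show "\<bar>F x + c3 * X x + c4 * Y x + c5 * Z x\<bar> \<le> C * s" using coef s by (simp add: algebra_simps)
    qed auto
    finally show ?thesis by (simp add: s_def algebra_simps)
  qed
  have kC: "2 * real k * C \<ge> 0" using C by simp
  obtain D where D: "D \<ge> 0" "\<And>u s t v w. 0 \<le> u \<Longrightarrow> 0 \<le> s \<Longrightarrow> 0 \<le> t \<Longrightarrow> t\<^sup>2 \<le> s * v \<Longrightarrow> 0 \<le> w \<Longrightarrow>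
       2 * real k * C * (sqrt u + s) * t * w \<le> \<epsilon> / 2 * (u + s\<^sup>2) + D * (v\<^sup>2 * w ^ 4)"
    by (rule gradient_cutoff_absorbed[OF e kC]) blast
  have e4: "\<epsilon> / 4 > 0" and a2: "a + 2 \<ge> 0" using e a p by auto
  obtain K where K: "K \<ge> 0" "\<And>v w. v > 0 \<Longrightarrow> w > 0 \<Longrightarrow>
       v powr a * (D * (v\<^sup>2 * w ^ 4)) \<le> \<epsilon> / 4 * v powr (a + 2 * p) + K * w powr \<sigma>"
    by (rule lower_order_absorbed[OF e4 D(1) a2 p(1), folded \<sigma>_def]) blast
  define E where "E R x = - (2 * real k / R\<^sup>2 * bump 0 R x ^ (k - 1)) *\<^sub>R (x - (0 :: real ^ 'n))" for R x
  define S where "S R x = v x powr a * (bump 0 R x ^ k * Q x + E R x \<bullet> W x)" for R x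
  have S: "integrable lborel (S R)" "(\<integral>x. S R x \<partial>lborel) = 0" if R: "R > 0" for R
  proof -
    have "integrable lborel (S R) \<and> (\<integral>x. S R x \<partial>lborel) = 0"
      unfolding S_def Q_def W_def U_def X_def F_def Y_def Z_def g_def
    proof (rule weighted_identity[OF v pos q, where R = R])
      show "laplacian v x + v x powr p + M * norm (grad v x) powr q = 0" for x
        using pde unfolding q_def .
      show "((\<lambda>x. bump 0 R x ^ k) has_derivative (\<lambda>u. E R x \<bullet> u)) (at x)" for x
        unfolding E_def by (rule has_derivative_bump_power[OF k(1) R])
      show "continuous_on UNIV (E R)" unfolding E_def by (rule continuous_bump_grad)
      show "bump 0 R x ^ k = 0" if "norm x > R" for x :: "real ^ 'n"
        using bump_eq_0[OF R, of x 0] that k by (simp add: zero_power)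
      show "grad v x \<bullet> (hess v x *v grad v x) = hh x * (grad v x \<bullet> grad v x)" for x
        using hh(1) unfolding g_def .
    qed
    then show "integrable lborel (S R)" "(\<integral>x. S R x \<partial>lborel) = 0" by auto
  qed
  have S_out: "S R x = 0" if "R > 0" "norm x \<ge> R" for R x
    using bump_eq_0[of R x 0] that k by (simp add: S_def E_def zero_power)
  have S_in: "S R x \<ge> bump 0 R x ^ k * (\<epsilon> / 4 * v x powr (a + 2 * p)) - K * R powr (- \<sigma>)"
    if R: "R > 0" "norm x < R" for R x
  proof -
    define \<phi> where "\<phi> = bump 0 R x"
    have "(norm x)\<^sup>2 < R\<^sup>2" using R by (intro power_strict_mono) auto
    then have phi: "0 < \<phi>" "\<phi> \<le> 1" using R bump_range(2)[of 0 R x] by (auto simp: \<phi>_def bump_def)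
    define w where "w = 1 / (R * \<phi>)"
    have w: "w > 0" using phi R by (simp add: w_def)
    define V where "V = v x powr a"
    have V: "V > 0" using pos[of x] by (simp add: V_def)
    define s where "s = X x + Y x"
    define N where "N = 2 * real k * C * (sqrt (U x) + s) * norm (g x) * w"
    have EW: "- (E R x \<bullet> W x) \<le> \<phi> ^ k * N"
    proof -
      have "- (E R x \<bullet> W x) \<le> norm (E R x) * norm (W x)"
        using Cauchy_Schwarz_ineq2[of "E R x" "W x"] by linarith
      also have "norm (E R x) \<le> 2 * real k / R * \<phi> ^ (k - 1)"
      proof -
        have "norm (E R x) = 2 * real k / R\<^sup>2 * \<phi> ^ (k - 1) * norm x"
          using phi by (simp add: E_def \<phi>_def abs_mult)
        also have "\<dots> \<le> 2 * real k / R\<^sup>2 * \<phi> ^ (k - 1) * R"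
          using R phi by (intro mult_left_mono) auto
        finally show ?thesis using R by (simp add: power2_eq_square)
      qed
      also have "2 * real k / R * \<phi> ^ (k - 1) * norm (W x)
          \<le> 2 * real k / R * \<phi> ^ (k - 1) * (C * (sqrt (U x) + s) * norm (g x))"
        using R phi Wb[of x] unfolding s_def by (intro mult_left_mono) auto
      also have "\<phi> ^ (k - 1) = \<phi> ^ k / \<phi>" using phi k by (simp add: power_diff)
      finally have "- (E R x \<bullet> W x)
          \<le> 2 * real k / R * (\<phi> ^ k / \<phi>) * (C * (sqrt (U x) + s) * norm (g x))"
        by (simp only: mult_right_mono norm_ge_zero)
      also have "\<dots> = \<phi> ^ k * N"
        unfolding N_def w_def by (simp only: divide_inverse inverse_mult_distrib mult_1 mult_ac)
      finally show ?thesis .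
    qed
    have "(norm (g x))\<^sup>2 \<le> s * v x"
    proof -
      have "(norm (g x))\<^sup>2 = X x * v x" using pos[of x] by (simp add: X_def)
      also have "\<dots> \<le> s * v x" using pos[of x] XY[of x] by (intro mult_right_mono) (auto simp: s_def)
      finally show ?thesis .
    qed
    then have N: "N \<le> \<epsilon> / 2 * (U x + s\<^sup>2) + D * ((v x)\<^sup>2 * w ^ 4)"
      unfolding N_def using XY[of x] w by (intro D(2)) (auto simp: s_def)
    have "\<phi> ^ k * (\<epsilon> * (U x + s\<^sup>2) - N) \<le> \<phi> ^ k * Q x + E R x \<bullet> W x"
    proof -
      have "\<phi> ^ k * (\<epsilon> * (U x + s\<^sup>2)) \<le> \<phi> ^ k * Q x"
        using Q[of x] phi unfolding s_def by (intro mult_left_mono) auto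
      then show ?thesis using EW unfolding right_diff_distrib by linarith
    qed
    then have "V * (\<phi> ^ k * (\<epsilon> * (U x + s\<^sup>2) - N)) \<le> S R x"
      using V unfolding S_def V_def \<phi>_def by (intro mult_left_mono) auto
    moreover have "\<phi> ^ k * (\<epsilon> / 4 * v x powr (a + 2 * p) - K * w powr \<sigma>) \<le> \<phi> ^ k * (V * (\<epsilon> * (U x + s\<^sup>2) - N))"
    proof (intro mult_left_mono)
      have "v x powr (2 * p) = (Y x)\<^sup>2"
        by (simp add: Y_def power2_eq_square powr_add[symmetric])
      also have "\<dots> \<le> s\<^sup>2" using XY[of x] by (intro power_mono) (auto simp: s_def)
      also have "\<dots> \<le> U x + s\<^sup>2" using XY by simp
      finally have "\<epsilon> / 2 * v x powr (2 * p) \<le> \<epsilon> / 2 * (U x + s\<^sup>2)" using e by (intro mult_left_mono) auto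
      with N have "\<epsilon> / 2 * v x powr (2 * p) - D * ((v x)\<^sup>2 * w ^ 4) \<le> \<epsilon> * (U x + s\<^sup>2) - N"
        by linarith
      then have "V * (\<epsilon> / 2 * v x powr (2 * p) - D * ((v x)\<^sup>2 * w ^ 4)) \<le> V * (\<epsilon> * (U x + s\<^sup>2) - N)"
        using V by (intro mult_left_mono) auto
      then have "V * (\<epsilon> / 2 * v x powr (2 * p)) - V * (D * ((v x)\<^sup>2 * w ^ 4)) \<le> V * (\<epsilon> * (U x + s\<^sup>2) - N)"
        unfolding right_diff_distrib[of V "\<epsilon> / 2 * v x powr (2 * p)"] .
      moreover have "V * (\<epsilon> / 2 * v x powr (2 * p)) = \<epsilon> / 2 * v x powr (a + 2 * p)"
        by (simp add: V_def powr_add)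
      ultimately show "\<epsilon> / 4 * v x powr (a + 2 * p) - K * w powr \<sigma> \<le> V * (\<epsilon> * (U x + s\<^sup>2) - N)"
        using K(2)[OF pos[of x] w, folded V_def] by argo
    qed (use phi in auto)
    ultimately have "\<phi> ^ k * (\<epsilon> / 4 * v x powr (a + 2 * p)) - K * (\<phi> ^ k * w powr \<sigma>) \<le> S R x"
      by (simp add: algebra_simps)
    moreover have "\<phi> ^ k * w powr \<sigma> \<le> R powr (- \<sigma>)"
    proof -
      have pk: "\<phi> ^ k = \<phi> powr real k" using phi by (simp add: powr_realpow)
      have "w powr \<sigma> = R powr (- \<sigma>) * \<phi> powr (- \<sigma>)"
        using R phi by (simp add: w_def powr_divide powr_mult powr_minus_divide)
      then have "\<phi> ^ k * w powr \<sigma> = R powr (- \<sigma>) * \<phi> powr (real k - \<sigma>)"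
        unfolding pk by (simp add: powr_diff powr_minus divide_inverse)
      also have "\<dots> \<le> R powr (- \<sigma>) * 1"
        using phi k by (intro mult_left_mono powr_le1) auto
      finally show ?thesis by simp
    qed
    then have "K * (\<phi> ^ k * w powr \<sigma>) \<le> K * R powr (- \<sigma>)" using K(1) by (intro mult_left_mono)
    ultimately show ?thesis unfolding \<phi>_def by linarith
  qed
  obtain m where m: "m > 0" "\<And>x. norm x \<le> 1 \<Longrightarrow> v x powr (a + 2 * p) \<ge> m"
  proof -
    have "continuous_on (cball 0 1) (\<lambda>x. v x powr (a + 2 * p))"
      using pos by (intro continuous_intros continuous_on_subset[OF C2_fun_continuous[OF v]])
        (auto simp: less_le)
    then obtain x0 where "x0 \<in> cball 0 1" "\<forall>x\<in>cball 0 1. v x0 powr (a + 2 * p) \<le> v x powr (a + 2 * p)"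
      using continuous_attains_inf[of "cball 0 1" "\<lambda>x. v x powr (a + 2 * p)"] by auto
    then show ?thesis using pos[of x0] by (intro that[of "v x0 powr (a + 2 * p)"]) auto
  qed
  define c where "c = (3 / 4) ^ k * (\<epsilon> / 4 * m)"
  have c: "c > 0" using e m by (simp add: c_def)
  have unit: "measure lborel (ball (0 :: real ^ 'n) R) = unit_ball_vol n * R powr n" if "R > 0" for R
    using that by (simp add: content_ball n_def powr_realpow)
  have key: "c \<le> K * R powr (n - \<sigma>)" if R: "R \<ge> 2" for R
  proof -
    \<comment> \<open>Adding the error term turns the vanishing integral of \<open>S R\<close> into the integral of a nonnegative
      function that is at least \<open>c\<close> on the unit ball.\<close>
    define f where "f x = S R x + K * R powr (- \<sigma>) * indicator (ball 0 R) x" for x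
    have R0: "R > 0" using R by simp
    have ii: "integrable lborel (\<lambda>x. K * R powr (- \<sigma>) * indicator (ball (0 :: real ^ 'n) R) x :: real)"
      by (intro integrable_mult_right integrable_real_indicator emeasure_bounded_finite) auto
    have "c * measure lborel (ball (0 :: real ^ 'n) 1) \<le> (\<integral>x. f x \<partial>lborel)"
    proof (rule integral_ge_on_ball)
      show "integrable lborel f" unfolding f_def using S(1)[OF R0] ii by simp
      show "0 \<le> f x" for x
      proof (cases "norm x < R")
        case True
        have "bump 0 R x ^ k * (\<epsilon> / 4 * v x powr (a + 2 * p)) \<ge> 0"
          using e bump_range(1)[of 0 R x] by (intro mult_nonneg_nonneg) auto
        then show ?thesis using S_in[OF R0 True] True by (simp add: f_def)
      next
        case False
        then show ?thesis using S_out[OF R0] by (simp add: f_def)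
      qed
      fix x :: "real ^ 'n" assume x: "x \<in> ball 0 1"
      then have x: "norm x < R" "norm x \<le> 1" "norm x \<le> R / 2" using R by auto
      have "(3 / 4) ^ k \<le> bump 0 R x ^ k"
        using bump_ge[OF R0, of x 0] x by (intro power_mono) auto
      then have "c \<le> bump 0 R x ^ k * (\<epsilon> / 4 * v x powr (a + 2 * p))"
        unfolding c_def using e m(1) m(2)[OF x(2)] bump_range(1)[of 0 R x] by (intro mult_mono) auto
      then show "c \<le> f x" using S_in[OF R0 x(1)] x by (simp add: f_def)
    qed
    also have "(\<integral>x. f x \<partial>lborel) = K * R powr (- \<sigma>) * measure lborel (ball (0 :: real ^ 'n) R)"
      unfolding f_def using S[OF R0] ii by simp
    finally have "c * unit_ball_vol n \<le> (K * R powr (n - \<sigma>)) * unit_ball_vol n"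
      using unit[OF R0] unit[of 1] R0 by (simp add: powr_diff powr_minus divide_inverse mult_ac)
    moreover have "unit_ball_vol n > 0" by (simp add: n_def)
    ultimately show ?thesis by simp
  qed
  have "((\<lambda>R. K * R powr (n - \<sigma>)) \<longlongrightarrow> K * 0) at_top"
    using sig by (intro tendsto_intros tendsto_neg_powr filterlim_ident) auto
  then have "((\<lambda>R. K * R powr (n - \<sigma>)) \<longlongrightarrow> 0) at_top" by simp
  moreover have "\<forall>\<^sub>F R in at_top. c \<le> K * R powr (n - \<sigma>)"
    using eventually_ge_at_top[of 2] by eventually_elim (rule key)
  ultimately have "c \<le> 0" by (rule tendsto_lowerbound) simp
  then show False using c by simp
qed

section \<open>The Liouville theorem\<close>

lemma nonneg_solution_eq_0:
  fixes v :: "real ^ 'n::finite \<Rightarrow> real" and p M :: real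
  assumes n: "CARD('n) \<ge> 3" and p: "1 < p" "p \<le> (real CARD('n) + 2) / (real CARD('n) - 2)"
    and M: "M > 0" and sol: "nonneg_solution p (q_exp p) M v"
  shows "v x = 0"
proof (rule ccontr)
  assume nz: "v x \<noteq> 0"
  have v: "C2_fun v" and nn: "\<And>x. v x \<ge> 0"
    and pde: "\<And>x. laplacian v x + v x powr p + M * norm (grad v x) powr (2 * p / (p + 1)) = 0"
    using sol by (auto simp: nonneg_solution_def q_exp_def)
  have "laplacian v y \<le> 0" for y
  proof -
    have "M * norm (grad v y) powr (2 * p / (p + 1)) \<ge> 0" using M by simp
    then show ?thesis using pde[of y] powr_ge_zero[of "v y" p] by linarith
  qed
  moreover have "v x > 0" using nn[of x] nz by simp
  ultimately have pos: "\<And>y. v y > 0" using superharmonic_positive[OF v nn] by blast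
  have n2: "real CARD('n) - 2 \<ge> 1" using n by simp
  then have crit: "(real CARD('n) - 2) * p \<le> real CARD('n) + 2"
    using p(2) by (simp add: le_divide_eq mult.commute)
  have "p \<le> 1 + 4 / (real CARD('n) - 2)"
    using p(2) n2 by (simp add: field_simps)
  also have "\<dots> \<le> 5" using n2 by (simp add: divide_le_eq)
  finally have "p \<le> 5" .
  then show False using no_positive_solution[OF v pos p(1) _ M crit pde] by simp
qed

text \<open>
For \<open>n \<ge> 7\<close> both brackets are positive: \<open>(n-1)^2 > 4n\<close> and \<open>q > 1\<close> settle the first, and
\<open>q \<le> (n+2)/n\<close>, which is the bound on \<open>p\<close>, settles the second.
\<close>

lemma M1_pos:
  assumes n: "n \<ge> 3" and p: "1 < p" "p \<le> (real n + 2) / (real n - 2)"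
  shows "M1 n p > 0"
proof (cases "n \<le> 6")
  case True
  then show ?thesis by (simp add: M1_def)
next
  case False
  define N where "N = real n"
  have N: "N \<ge> 7" using False by (simp add: N_def)
  have q1: "q_exp p > 1" using p(1) by (simp add: q_exp_def field_simps)
  have q2: "q_exp p \<le> (N + 2) / N"
  proof -
    have "p * (N - 2) \<le> N + 2" using p(2) N by (simp add: N_def le_divide_eq)
    then show ?thesis using p(1) N by (simp add: q_exp_def field_simps)
  qed
  have "(N - 1)\<^sup>2 > 4 * N"
  proof -
    have "N * N \<ge> 7 * N" using N by (intro mult_right_mono) auto
    moreover have "(N - 1)\<^sup>2 = N * N - 2 * N + 1" by (simp add: power2_eq_square algebra_simps)
    ultimately show ?thesis using N by linarith
  qed
  moreover have "(N - 1)\<^sup>2 * q_exp p \<ge> (N - 1)\<^sup>2 * 1" using q1 by (intro mult_left_mono) auto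
  ultimately have "4 * N < (N - 1)\<^sup>2 * q_exp p" by linarith
  then have a: "(N - 1)\<^sup>2 * q_exp p / (4 * N) - 1 > 0" using N by (simp add: field_simps)
  have "N / q_exp p \<ge> N / ((N + 2) / N)" using q1 q2 N by (intro divide_left_mono) auto
  also have "N / ((N + 2) / N) = N * N / (N + 2)" by simp
  finally have "N / q_exp p \<ge> N * N / (N + 2)" .
  moreover have "N * N / (N + 2) > N * (N - 1) / (N + 2)"
    using N by (intro divide_strict_right_mono mult_strict_left_mono) auto
  ultimately have b: "N / q_exp p - N * (N - 1) / (N + 2) > 0" by simp
  show ?thesis using False p(1) a b by (simp add: M1_def N_def)
qed

theorem lemma1p1:
  fixes n :: nat and p q :: real
  assumes "CARD('n::finite) = n"
    and "n \<ge> 3"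
    and "1 < p" and "p \<le> (real n + 2) / (real n - 2)"
    and "q = q_exp p"
  shows "(\<forall>M::real. 0 < M \<and> ereal M < M1 n p \<longrightarrow>
            (\<forall>v :: real ^ 'n \<Rightarrow> real. nonneg_solution p q M v \<longrightarrow> (\<forall>x. v x = 0)))
       \<and> (\<exists>M2::real. M2 > 0 \<and> ereal M2 < M1 n p \<and>
            (\<forall>M::real. M > M2 \<longrightarrow>
               (\<forall>v :: real ^ 'n \<Rightarrow> real. nonneg_solution p q M v \<longrightarrow> (\<forall>x. v x = 0))))"
proof -
  have zero: "v x = 0" if "M > 0" "nonneg_solution p q M v" for M and v :: "real ^ 'n \<Rightarrow> real" and x
    using nonneg_solution_eq_0[of p M v x] that assms by simp
  have "0 < M1 n p" by (rule M1_pos[OF assms(2-4)])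
  then obtain M2 :: real where "0 < ereal M2" and M2: "ereal M2 < M1 n p"
    using ereal_dense2 by blast
  then have "M2 > 0" by simp
  then have "v x = 0" if "M > M2" "nonneg_solution p q M v" for M and v :: "real ^ 'n \<Rightarrow> real" and x
    using zero[of M v x] that by simp
  with \<open>M2 > 0\<close> M2 zero show ?thesis by blast
qed

end
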